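(* Let $\mathcal S\subset\mathbb R^{2n}$ satisfy Assumption 1, let $A^*$ be the chosen target polynomial and $\underline\lambda$ the largest modulus of a root of $z^{2n}A^*(z^{-1})$. For every $\delta\in(0,\infty]$, $\lambda_1\in(\underline\lambda,1)$ and $c_0\ge 0$ there exist $c_1>0$ and $\varepsilon>0$ such that for every $t_0\in\mathbb Z$, $\theta_0\in\mathcal S$, $\theta^*\in s(\mathcal S,c_0,\varepsilon)$, $\phi_0\in\mathbb R^{2n}$ and $y^*,d\in\ell_\infty$, when the adaptive controller (the estimator with parameter $\delta$ and $\hat\theta(t_0)=\theta_0$, together with the pole placement control law, as described in the context) is applied to the time-varying plant $y(t+1)=\phi(t)^T\theta^*(t)+d(t)$, $\phi(t_0)=\phi_0$, $t\ge t_0$, the following holds: $$\|\phi(k)\|\le c_1\lambda_1^{k-t_0}\|\phi_0\|+\sum_{j=t_0}^{k-1}c_1\lambda_1^{k-1-j}\bigl(|r(j)|+|d(j)|\bigr),\qquad k\ge t_0,$$ where $r(t)=\sum_{i=1}^n\hat p_i(t)\,y^*(t+1-i)$.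
   Context: Norms: $\|\cdot\|$ is the Euclidean norm on vectors and the induced norm on matrices. $\ell_\infty$ (resp. $\ell_\infty(\mathbb R^{2n})$) is the set of bounded real-valued (resp. $\mathbb R^{2n}$-valued) sequences indexed by $\mathbb Z$. Time-varying plant. Fix $n\in\mathbb N$. For real sequences $y,u$ put $\phi(t)=[y(t),\dots,y(t-n+1),u(t),\dots,u(t-n+1)]^T\in\mathbb R^{2n}$. The plant is $y(t+1)=\phi(t)^T\theta^*(t)+d(t)$, $t\ge t_0$, $\phi(t_0)=\phi_0$ (so $\phi_0$ specifies $y(t_0),\dots,y(t_0-n+1),u(t_0),\dots,u(t_0-n+1)$), with $d$ the disturbance, $u$ the control input, $y$ the output. Assumption 1 on the (fixed, known) parameter set $\mathcal S\subset\mathbb R^{2n}$: $\mathcal S$ is (nonempty) convex and compact, and for each $\theta=[-a_1,\dots,-a_n,b_1,\dots,b_n]^T\in\mathcal S$ the polynomials $A(z^{-1})=1+a_1z^{-1}+\dots+a_nz^{-n}$ and $B(z^{-1})=b_1z^{-1}+\dots+b_nz^{-n}$ are coprime, in the sense that $z^nA(z^{-1})$ and $z^nB(z^{-1})$ are coprime polynomials in $z$. Put $\|\mathcal S\|=\max_{x\in\mathcal S}\|x\|$ and let $\pi_{\mathcal S}:\mathbb R^{2n}\to\mathcal S$ be the Euclidean projection onto $\mathcal S$. Admissible time variations. For $c_0\ge0$, $\varepsilon>0$, $s(\mathcal S,c_0,\varepsilon)$ is the set of $\theta^*\in\ell_\infty(\mathbb R^{2n})$ with $\theta^*(t)\in\mathcal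 S$ for every $t\in\mathbb Z$ and $$\sum_{t=t_1}^{t_2-1}\|\theta^*(t+1)-\theta^*(t)\|\le c_0+\varepsilon(t_2-t_1)\quad\text{for all }t_1,t_2\in\mathbb Z,\ t_2>t_1.$$ Estimator. Let $\delta\in(0,\infty]$, with the convention $\infty\cdot 0=0$. Set $\hat\theta(t_0)=\theta_0\in\mathcal S$ and, for $t\ge t_0$, let $e(t+1)=y(t+1)-\phi(t)^T\hat\theta(t)$ (prediction error). Define $\rho_\delta(\phi(t),e(t+1))=1$ if $|e(t+1)|<(2\|\mathcal S\|+\delta)\|\phi(t)\|$ and $=0$ otherwise (so it is $0$ when $\phi(t)=0$). Then $$\check\theta(t+1)=\hat\theta(t)+\rho_\delta(\phi(t),e(t+1))\frac{\phi(t)}{\phi(t)^T\phi(t)}e(t+1),\qquad \hat\theta(t+1)=\pi_{\mathcal S}(\check\theta(t+1)),$$ where the update term is taken to be $0$ whenever $\rho_\delta=0$. Control law. Fix once and for all $A^*(z^{-1})=1+a_1^*z^{-1}+\dots+a_{2n}^*z^{-2n}$ such that all zeros of $z^{2n}A^*(z^{-1})$ lie in the open unit disk; $\underline\lambda=\max\{|\lambda|:\lambda\text{ a root of }z^{2n}A^*(z^{-1})\}$. Write $\hat\theta(t)=[-\hat a_1(t),\dots,-\hat a_n(t),\hat b_1(t),\dots,\hat b_n(t)]^T$, $\hat A(t,z^{-1})=1+\sum_{i=1}^n\hat a_i(t)z^{-i}$, $\hat B(t,z^{-1})=\sum_{i=1}^n\hat b_i(t)z^{-i}$, and let $\hat L(t,z^{-1})=1+\sum_{i=1}^n\hat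 l_i(t)z^{-i}$, $\hat P(t,z^{-1})=\sum_{i=1}^n\hat p_i(t)z^{-i}$ be the unique polynomials of this form with $\hat A\hat L+\hat B\hat P=A^*$. For an exogenous reference signal $y^*$ (a sequence on $\mathbb Z$), the control is, for $t\ge t_0+1$, $$u(t)=-\sum_{i=1}^n\hat l_i(t-1)u(t-i)-\sum_{i=1}^n\hat p_i(t-1)\,[y(t-i)-y^*(t-i)].$$ *)

theory Defs
  imports "HOL-Analysis.Analysis" "HOL-Computational_Algebra.Polynomial"
begin

text \<open>
  Vectors in \<open>\<real>\<^sup>2\<^sup>n\<close> are pairs in \<open>real ^ 'n \<times> real ^ 'n\<close> with \<open>n = CARD('n)\<close>; the norm and inner
  product of the product type are the Euclidean ones.  Since \<open>'n\<close> carries no order, every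
  definition takes a numbering \<open>pos\<close> of the coordinates, a bijection from \<open>'n\<close> onto \<open>{1..n}\<close>;
  a sum over \<open>i = 1, \<dots>, n\<close> is then a sum over the type \<open>'n\<close> with \<open>pos i\<close> for the number of \<open>i\<close>.
  Signals are sequences on \<open>int\<close>.
\<close>

type_synonym 'n param = "(real ^ 'n) \<times> (real ^ 'n)"

definition numbering :: "('n::finite \<Rightarrow> nat) \<Rightarrow> bool" where
  "numbering pos \<longleftrightarrow> bij_betw pos UNIV {1..CARD('n)}"

definition regressor ::
    "('n::finite \<Rightarrow> nat) \<Rightarrow> (int \<Rightarrow> real) \<Rightarrow> (int \<Rightarrow> real) \<Rightarrow> int \<Rightarrow> 'n param" where
  "regressor pos y u t =
     ((\<chi> i. y (t - int (pos i) + 1)), (\<chi> i. u (t - int (pos i) + 1)))"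

text \<open>
  A polynomial in \<open>z\<^sup>-\<^sup>1\<close> is a \<open>real poly\<close> whose indeterminate stands for \<open>z\<^sup>-\<^sup>1\<close>.
  The following is \<open>v\<^sub>1 z\<^sup>-\<^sup>1 + \<dots> + v\<^sub>n z\<^sup>-\<^sup>n\<close>.
\<close>

definition delay_poly :: "('n::finite \<Rightarrow> nat) \<Rightarrow> real ^ 'n \<Rightarrow> real poly" where
  "delay_poly pos v = (\<Sum>i\<in>UNIV. monom (v $ i) (pos i))"

text \<open>The first half of a parameter vector holds \<open>-a\<^sub>1, \<dots>, -a\<^sub>n\<close>, hence the sign.\<close>

definition polyA :: "('n::finite \<Rightarrow> nat) \<Rightarrow> 'n param \<Rightarrow> real poly" where
  "polyA pos \<theta> = 1 + delay_poly pos (- fst \<theta>)"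

definition polyB :: "('n::finite \<Rightarrow> nat) \<Rightarrow> 'n param \<Rightarrow> real poly" where
  "polyB pos \<theta> = delay_poly pos (snd \<theta>)"

text \<open>
  \<open>z\<^sup>N Q(z\<^sup>-\<^sup>1)\<close> as a polynomial in \<open>z\<close>, for \<open>Q\<close> of degree at most \<open>N\<close>.  This is not
  \<^const>\<open>reflect_poly\<close>, which would use the degree of \<open>Q\<close> instead of \<open>N\<close>.
\<close>

definition forward_poly :: "nat \<Rightarrow> real poly \<Rightarrow> real poly" where
  "forward_poly N Q = (\<Sum>i\<le>N. monom (coeff Q i) (N - i))"

definition parameter_set :: "('n::finite \<Rightarrow> nat) \<Rightarrow> 'n param set \<Rightarrow> bool" where
  "parameter_set pos S \<longleftrightarrow> S \<noteq> {} \<and> convex S \<and> compact S \<and>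
     (\<forall>\<theta>\<in>S. coprime (forward_poly CARD('n) (polyA pos \<theta>))
                     (forward_poly CARD('n) (polyB pos \<theta>)))"

text \<open>For nonempty compact \<open>S\<close> the supremum is attained.\<close>

definition set_norm :: "'n::finite param set \<Rightarrow> real" where
  "set_norm S = (SUP x\<in>S. norm x)"

definition admissible ::
    "'n::finite param set \<Rightarrow> real \<Rightarrow> real \<Rightarrow> (int \<Rightarrow> 'n param) set" where
  "admissible S c0 \<epsilon> = {\<theta>. bounded (range \<theta>) \<and> (\<forall>t. \<theta> t \<in> S) \<and>
     (\<forall>t1 t2. t1 < t2 \<longrightarrow>
        (\<Sum>t=t1..t2-1. norm (\<theta> (t + 1) - \<theta> t)) \<le> c0 + \<epsilon> * real_of_int (t2 - t1))}"

text \<open>On \<^typ>\<open>ereal\<close> the product \<open>\<infinity> * 0\<close> is \<open>0\<close>, so \<open>rho\<close> vanishes at \<open>\<phi> = 0\<close> also for \<open>\<delta> = \<infinity>\<close>.\<close>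

definition rho :: "'n::finite param set \<Rightarrow> ereal \<Rightarrow> 'n param \<Rightarrow> real \<Rightarrow> real" where
  "rho S \<delta> \<phi> e =
     (if ereal \<bar>e\<bar> < (ereal (2 * set_norm S) + \<delta>) * ereal (norm \<phi>) then 1 else 0)"

definition estimator_step ::
    "'n::finite param set \<Rightarrow> ereal \<Rightarrow> 'n param \<Rightarrow> real \<Rightarrow> 'n param \<Rightarrow> 'n param" where
  "estimator_step S \<delta> \<phi> y_next \<theta> =
     (let e = y_next - \<phi> \<bullet> \<theta>
      in closest_point S (\<theta> + (rho S \<delta> \<phi> e * e / (\<phi> \<bullet> \<phi>)) *\<^sub>R \<phi>))"

definition target_poly :: "nat \<Rightarrow> real poly \<Rightarrow> bool" where
  "target_poly N Q \<longleftrightarrow> coeff Q 0 = 1 \<and> degree Q \<le> N \<and>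
     (\<forall>z::complex. poly (map_poly of_real (forward_poly N Q)) z = 0 \<longrightarrow> cmod z < 1)"

definition root_radius :: "nat \<Rightarrow> real poly \<Rightarrow> real" where
  "root_radius N Q =
     Max (cmod ` {z. poly (map_poly of_real (forward_poly N Q)) z = 0})"

text \<open>
  The coefficient vectors \<open>(l, p)\<close> of the unique solution of \<open>A L + B P = A\<^sup>*\<close> with
  \<open>L = 1 + l\<^sub>1 z\<^sup>-\<^sup>1 + \<dots> + l\<^sub>n z\<^sup>-\<^sup>n\<close> and \<open>P = p\<^sub>1 z\<^sup>-\<^sup>1 + \<dots> + p\<^sub>n z\<^sup>-\<^sup>n\<close>; coprimeness of \<open>A\<close>
  and \<open>B\<close> guarantees that it exists.
\<close>

definition pole_placement ::
    "('n::finite \<Rightarrow> nat) \<Rightarrow> real poly \<Rightarrow> 'n param \<Rightarrow> (real ^ 'n) \<times> (real ^ 'n)" where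
  "pole_placement pos Astar \<theta> =
     (THE lp. polyA pos \<theta> * (1 + delay_poly pos (fst lp))
            + polyB pos \<theta> * delay_poly pos (snd lp) = Astar)"

definition gainL :: "('n::finite \<Rightarrow> nat) \<Rightarrow> real poly \<Rightarrow> 'n param \<Rightarrow> real ^ 'n" where
  "gainL pos Astar \<theta> = fst (pole_placement pos Astar \<theta>)"

definition gainP :: "('n::finite \<Rightarrow> nat) \<Rightarrow> real poly \<Rightarrow> 'n param \<Rightarrow> real ^ 'n" where
  "gainP pos Astar \<theta> = snd (pole_placement pos Astar \<theta>)"

definition filtered_ref ::
    "('n::finite \<Rightarrow> nat) \<Rightarrow> real poly \<Rightarrow> (int \<Rightarrow> 'n param) \<Rightarrow> (int \<Rightarrow> real) \<Rightarrow> int \<Rightarrow> real" where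
  "filtered_ref pos Astar \<theta>hat ystar t =
     (\<Sum>i\<in>UNIV. gainP pos Astar (\<theta>hat t) $ i * ystar (t + 1 - int (pos i)))"

definition closed_loop ::
    "('n::finite \<Rightarrow> nat) \<Rightarrow> 'n param set \<Rightarrow> real poly \<Rightarrow> ereal \<Rightarrow> int \<Rightarrow> 'n param \<Rightarrow>
     (int \<Rightarrow> 'n param) \<Rightarrow> 'n param \<Rightarrow> (int \<Rightarrow> real) \<Rightarrow> (int \<Rightarrow> real) \<Rightarrow>
     (int \<Rightarrow> real) \<Rightarrow> (int \<Rightarrow> real) \<Rightarrow> (int \<Rightarrow> 'n param) \<Rightarrow> bool" where
  "closed_loop pos S Astar \<delta> t0 \<theta>0 \<theta>star \<phi>0 ystar d y u \<theta>hat \<longleftrightarrow>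
     regressor pos y u t0 = \<phi>0 \<and>
     (\<forall>t\<ge>t0. y (t + 1) = regressor pos y u t \<bullet> \<theta>star t + d t) \<and>
     \<theta>hat t0 = \<theta>0 \<and>
     (\<forall>t\<ge>t0. \<theta>hat (t + 1) = estimator_step S \<delta> (regressor pos y u t) (y (t + 1)) (\<theta>hat t)) \<and>
     (\<forall>t\<ge>t0 + 1. u t =
        - (\<Sum>i\<in>UNIV. gainL pos Astar (\<theta>hat (t - 1)) $ i * u (t - int (pos i)))
        - (\<Sum>i\<in>UNIV. gainP pos Astar (\<theta>hat (t - 1)) $ i *
             (y (t - int (pos i)) - ystar (t - int (pos i)))))"

end

theory Submission
  imports
    Defs
    "HOL-Computational_Algebra.Fundamental_Theorem_Algebra"
    "HOL-Computational_Algebra.Polynomial_Factorial"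
    "HOL-Computational_Algebra.Field_as_Ring"
begin

text \<open>
  For a frozen estimate \<open>\<theta>\<close> the closed loop is a linear map \<open>F \<theta>\<close> whose trajectories satisfy the
  scalar recurrence with characteristic polynomial \<open>z\<^sup>2\<^sup>n A\<^sup>*(z\<^sup>-\<^sup>1)\<close>, so its powers decay
  uniformly over \<open>S\<close>; by compactness and coprimeness the gains, hence \<open>F\<close>, are Lipschitz in \<open>\<theta>\<close>.
  Consequently the norm \<open>N \<theta> x = sup\<^sub>k \<mu>\<^sup>-\<^sup>k \<bar>(F \<theta>)\<^sup>k x\<bar>\<close> contracts by \<open>\<mu>\<close> under \<open>F \<theta>\<close> and grows at most
  by a factor \<open>1 + C \<bar>\<theta>' - \<theta>\<bar>\<close> when \<open>\<theta>\<close> is replaced by \<open>\<theta>'\<close>.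

  Call a time good if \<open>\<bar>d(t)\<bar> < \<upsilon> \<bar>\<phi>(t)\<bar>\<close>.  At good times the estimator is active and the prediction error
  acts as a perturbation of \<open>F\<close> of size \<open>\<nu>(t) = \<bar>e(t + 1)\<bar> / \<bar>\<phi>(t)\<bar>\<close>, which also bounds the change of the
  estimate.  The squared parameter error bounds the sum of \<open>\<nu>\<^sup>2\<close> over a stretch of good times by
  a constant plus a small multiple of its length, so that the decay rate \<open>\<mu>\<close> deteriorates at most to
  \<open>\<lambda>\<^sub>1\<close>.  At the last bad time before \<open>k\<close> the state is itself dominated by the disturbance, so the
  estimate can be restarted there.
\<close>

section \<open>Shift operators and reversed polynomials\<close>

text \<open>Polynomials act on sequences as difference operators, the indeterminate being the
  forward shift. Products become compositions, so the loop equations can be eliminated by polynomial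
  algebra.\<close>

definition shift_op :: "'a::comm_ring_1 poly \<Rightarrow> (nat \<Rightarrow> 'a) \<Rightarrow> nat \<Rightarrow> 'a" where
  "shift_op p y k = (\<Sum>i\<le>degree p. coeff p i * y (k + i))"

lemma shift_op_eq:
  assumes "degree p \<le> N"
  shows "shift_op p y k = (\<Sum>i\<le>N. coeff p i * y (k + i))"
  unfolding shift_op_def using assms
  by (intro sum.mono_neutral_left) (auto simp: coeff_eq_0)

lemma shift_op_0 [simp]: "shift_op 0 y k = 0"
  by (simp add: shift_op_def)

lemma shift_op_add: "shift_op (p + q) y k = shift_op p y k + shift_op q y k"
proof -
  define N where "N = max (degree p) (degree q)"
  have "degree (p + q) \<le> N" "degree p \<le> N" "degree q \<le> N"
    by (auto simp: N_def degree_add_le_max)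
  then show ?thesis
    by (simp add: shift_op_eq algebra_simps sum.distrib)
qed

lemma shift_op_smult: "shift_op (smult a p) y k = a * shift_op p y k"
proof -
  have "degree (smult a p) \<le> degree p" by (rule degree_smult_le)
  from shift_op_eq[OF this] show ?thesis
    by (simp add: shift_op_def sum_distrib_left mult.assoc)
qed

lemma shift_op_pCons: "shift_op (pCons a p) y k = a * y k + shift_op p y (Suc k)"
proof -
  have "degree (pCons a p) \<le> Suc (degree p)" by (rule degree_pCons_le)
  from shift_op_eq[OF this] show ?thesis
    by (simp add: shift_op_def sum.atMost_Suc_shift del: sum.atMost_Suc)
qed

lemma shift_op_mult: "shift_op (p * q) y k = shift_op p (shift_op q y) k"
  by (induction p arbitrary: k)
     (simp_all add: mult_pCons_left shift_op_add shift_op_smult shift_op_pCons)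

lemma shift_op_arg_add:
  "shift_op p (\<lambda>k. f k + g k) k = shift_op p f k + shift_op p g k"
  by (simp add: shift_op_def algebra_simps sum.distrib)

lemma shift_op_map_poly_of_real:
  "shift_op (map_poly of_real p) (\<lambda>k. of_real (y k)) k = (of_real (shift_op p y k) :: complex)"
proof -
  have "degree (map_poly of_real p :: complex poly) = degree p"
    by (rule degree_map_poly) auto
  then show ?thesis by (simp add: shift_op_def coeff_map_poly)
qed

text \<open>The condition on \<open>G\<close> is what closes the induction: the forcing
  \<open>M\<close> and the homogeneous part \<open>cmod r * G\<close> together fit into
  \<open>G * lam\<close>.\<close>

lemma first_order_decay:
  fixes v :: "nat \<Rightarrow> complex"
  assumes "cmod r < lam" and step: "\<And>k. cmod (v (Suc k) - r * v k) \<le> M * lam ^ k"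
    and v0: "cmod (v 0) \<le> G" and G: "M \<le> G * (lam - cmod r)"
  shows "cmod (v k) \<le> G * lam ^ k"
proof (induction k)
  case 0
  then show ?case using v0 by simp
next
  case (Suc k)
  have lam: "0 \<le> lam" using assms(1) norm_ge_zero[of r] by linarith
  have "cmod (v (Suc k)) \<le> cmod (v (Suc k) - r * v k) + cmod (r * v k)"
    using norm_triangle_ineq[of "v (Suc k) - r * v k" "r * v k"] by simp
  also have "\<dots> \<le> M * lam ^ k + cmod r * (G * lam ^ k)"
    using step[of k] Suc by (auto simp: norm_mult intro!: add_mono mult_left_mono)
  also have "\<dots> \<le> (G * (lam - cmod r)) * lam ^ k + cmod r * (G * lam ^ k)"
    using G lam by (auto intro!: mult_right_mono)
  also have "\<dots> = G * lam ^ Suc k" by (simp add: algebra_simps)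
  finally show ?case .
qed

text \<open>Induction on the degree: with \<open>p = [:- r, 1:] * q\<close>, the sequence
  \<open>shift_op q y\<close> obeys a first-order recurrence with root \<open>r\<close>, and the
  hypothesis for \<open>q\<close> then handles \<open>y\<close>. Allowing a decaying right-hand side
  makes the induction go through; multiple roots need no special care because every root lies
  strictly inside radius \<open>lam\<close>. The constant is independent of \<open>y\<close> and
  \<open>M\<close>.\<close>

lemma shift_op_decay:
  fixes p :: "complex poly"
  assumes "p \<noteq> 0" and "0 < lam" and "\<And>z. poly p z = 0 \<Longrightarrow> cmod z < lam"
  shows "\<exists>\<gamma>. \<forall>y M. (\<forall>k. cmod (shift_op p y k) \<le> M * lam ^ k) \<longrightarrow>
           (\<forall>i<degree p. cmod (y i) \<le> M) \<longrightarrow> (\<forall>k. cmod (y k) \<le> \<gamma> * M * lam ^ k)"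
  using assms
proof (induction "degree p" arbitrary: p)
  case 0
  then obtain c where p: "p = [:c:]" by (metis degree_eq_zeroE)
  with 0 have c: "c \<noteq> 0" by auto
  show ?case
  proof (intro exI[of _ "1 / cmod c"] allI impI)
    fix y M k
    assume "\<forall>k. cmod (shift_op p y k) \<le> M * lam ^ k"
    then have "cmod c * cmod (y k) \<le> M * lam ^ k"
      by (auto simp: p shift_op_pCons norm_mult)
    then show "cmod (y k) \<le> 1 / cmod c * M * lam ^ k"
      using c by (simp add: field_simps)
  qed
next
  case (Suc n)
  have "\<not> constant (poly p)" using Suc.hyps(2) by (simp add: constant_degree)
  then obtain r where r: "poly p r = 0"
    using fundamental_theorem_of_algebra by blast
  then obtain q where q: "p = [:- r, 1:] * q" by (auto simp: poly_eq_0_iff_dvd)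
  have q0: "q \<noteq> 0" using Suc.prems q by auto
  have "degree p = degree [:- r, 1:] + degree q"
    unfolding q by (rule degree_mult_eq) (use q0 in auto)
  then have deg: "degree q = n" using Suc.hyps(2) by simp
  have rl: "cmod r < lam" using r Suc.prems by auto
  have "\<exists>\<gamma>. \<forall>y M. (\<forall>k. cmod (shift_op q y k) \<le> M * lam ^ k) \<longrightarrow>
           (\<forall>i<degree q. cmod (y i) \<le> M) \<longrightarrow> (\<forall>k. cmod (y k) \<le> \<gamma> * M * lam ^ k)"
    by (rule Suc.hyps(1)) (use deg q0 Suc.prems q in auto)
  then obtain \<gamma> where \<gamma>: "\<And>y M k. (\<forall>k. cmod (shift_op q y k) \<le> M * lam ^ k) \<Longrightarrow>
           (\<forall>i<degree q. cmod (y i) \<le> M) \<Longrightarrow> cmod (y k) \<le> \<gamma> * M * lam ^ k"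
    by blast
  \<comment> \<open>The sum bounds \<open>v 0\<close> by the initial values of \<open>y\<close>; the
    second summand supplies the condition of \<open>first_order_decay\<close>.\<close>
  define B where "B = (\<Sum>i\<le>n. cmod (coeff q i)) + 1 / (lam - cmod r)"
  have B1: "0 \<le> B" unfolding B_def using rl by (auto intro!: add_nonneg_nonneg sum_nonneg)
  show ?case
  proof (intro exI[of _ "\<gamma> * (B + 1)"] allI impI)
    fix y M k
    assume a1: "\<forall>k. cmod (shift_op p y k) \<le> M * lam ^ k"
      and a2: "\<forall>i<degree p. cmod (y i) \<le> M"
    have M: "0 \<le> M" using order_trans[OF norm_ge_zero a1[rule_format, of 0]] by simp
    define v where "v = shift_op q y"
    have v_le: "cmod (v k) \<le> (B * M) * lam ^ k" for k
    proof (rule first_order_decay[OF rl])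
      show "cmod (v (Suc k) - r * v k) \<le> M * lam ^ k" for k
        using a1[rule_format, of k] unfolding q shift_op_mult
        by (simp add: v_def shift_op_pCons)
      have "cmod (v 0) \<le> (\<Sum>i\<le>n. cmod (coeff q i) * M)"
        unfolding v_def shift_op_def deg
        by (rule order_trans[OF norm_sum sum_mono])
           (use a2 Suc.hyps(2) in \<open>auto simp: norm_mult intro!: mult_left_mono\<close>)
      also have "\<dots> \<le> B * M"
        unfolding B_def using rl M by (simp add: sum_distrib_right[symmetric] distrib_right)
      finally show "cmod (v 0) \<le> B * M" .
      have "1 / (lam - cmod r) \<le> B" unfolding B_def by (simp add: sum_nonneg)
      then have "1 \<le> B * (lam - cmod r)" using rl by (simp add: field_simps)
      from mult_right_mono[OF this M] show "M \<le> B * M * (lam - cmod r)"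
        by (simp add: mult_ac)
    qed
    \<comment> \<open>The hypothesis for \<open>q\<close> wants one constant for both forcing and
      initial values; \<open>B * M\<close> serves the first, \<open>M\<close> the second, and
      \<open>(B + 1) * M\<close> both.\<close>
    have "cmod (y k) \<le> \<gamma> * ((B + 1) * M) * lam ^ k"
    proof (rule \<gamma>)
      show "\<forall>k. cmod (shift_op q y k) \<le> (B + 1) * M * lam ^ k"
      proof
        fix k
        have "B * M * lam ^ k \<le> (B + 1) * M * lam ^ k"
          using M Suc.prems(2) by (auto intro!: mult_right_mono)
        with v_le[of k] show "cmod (shift_op q y k) \<le> (B + 1) * M * lam ^ k"
          unfolding v_def by linarith
      qed
      show "\<forall>i<degree q. cmod (y i) \<le> (B + 1) * M"
      proof (intro allI impI)
        fix i assume "i < degree q"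
        then have "cmod (y i) \<le> M" using a2 deg Suc.hyps(2) by auto
        also have "M \<le> (B + 1) * M" using M B1 by (simp add: algebra_simps)
        finally show "cmod (y i) \<le> (B + 1) * M" .
      qed
    qed
    then show "cmod (y k) \<le> \<gamma> * (B + 1) * M * lam ^ k" by (simp add: mult_ac)
  qed
qed

lemma coeff_forward_poly: "coeff (forward_poly N Q) j = (if j \<le> N then coeff Q (N - j) else 0)"
proof -
  have "coeff (forward_poly N Q) j = (\<Sum>i\<le>N. if N - i = j then coeff Q i else 0)"
    by (simp add: forward_poly_def coeff_sum)
  also have "\<dots> = (\<Sum>i\<le>N. if i = N - j then (if j \<le> N then coeff Q (N - j) else 0) else 0)"
    by (rule sum.cong) auto
  finally show ?thesis by simp
qed

lemma degree_forward_poly_le: "degree (forward_poly N Q) \<le> N"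
  by (rule degree_le) (simp add: coeff_forward_poly)

lemma forward_poly_add: "forward_poly N (p + q) = forward_poly N p + forward_poly N q"
  by (rule poly_eqI) (simp add: coeff_forward_poly)

text \<open>The reversed polynomial at \<open>k\<close> is the original delay operator at
  \<open>k + N\<close>, so only indices in \<nat> occur.\<close>

lemma shift_op_forward_poly:
  "shift_op (forward_poly N Q) y k = (\<Sum>j\<le>N. coeff Q j * y (k + N - j))"
proof -
  have "shift_op (forward_poly N Q) y k = (\<Sum>i\<le>N. coeff Q (N - i) * y (k + i))"
    by (simp add: shift_op_eq[OF degree_forward_poly_le] coeff_forward_poly)
  also have "\<dots> = (\<Sum>j\<le>N. coeff Q j * y (k + N - j))"
    by (rule sum.reindex_bij_witness[of _ "\<lambda>j. N - j" "\<lambda>j. N - j"]) auto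
  finally show ?thesis .
qed

lemma poly_forward_poly:
  assumes "degree Q \<le> N" "z \<noteq> 0"
  shows "poly (forward_poly N Q) z = z ^ N * poly Q (inverse z)"
proof -
  have "poly (forward_poly N Q) z = (\<Sum>i\<le>N. coeff Q i * z ^ (N - i))"
    by (simp add: forward_poly_def poly_sum poly_monom)
  also have "\<dots> = (\<Sum>i\<le>N. z ^ N * (coeff Q i * inverse z ^ i))"
    by (rule sum.cong) (use assms in \<open>auto simp: power_diff field_simps\<close>)
  also have "\<dots> = z ^ N * (\<Sum>i\<le>N. coeff Q i * inverse z ^ i)"
    by (simp add: sum_distrib_left)
  also have "(\<Sum>i\<le>N. coeff Q i * inverse z ^ i) = poly Q (inverse z)"
    unfolding poly_altdef using assms
    by (intro sum.mono_neutral_right) (auto simp: coeff_eq_0)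
  finally show ?thesis .
qed

text \<open>Multiplying the difference by the indeterminate takes care of the point 0. Identities
  between reversed polynomials can thus be checked where \<open>inverse z\<close> makes
  sense.\<close>

lemma poly_eqI_nonzero:
  fixes p q :: "real poly"
  assumes "\<And>z. z \<noteq> 0 \<Longrightarrow> poly p z = poly q z"
  shows "p = q"
proof -
  have "poly ([:0, 1:] * (p - q)) = poly 0"
    using assms by (auto simp: fun_eq_iff)
  then have "[:0, 1:] * (p - q) = 0" by (simp add: poly_eq_poly_eq_iff)
  then show ?thesis by simp
qed

lemma forward_poly_mult:
  assumes "degree p \<le> m" "degree q \<le> n"
  shows "forward_poly (m + n) (p * q) = forward_poly m p * forward_poly n q"
proof (rule poly_eqI_nonzero)
  fix z :: real assume z: "z \<noteq> 0"
  have "degree (p * q) \<le> m + n"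
    using assms degree_mult_le[of p q] by linarith
  with z assms show "poly (forward_poly (m + n) (p * q)) z
      = poly (forward_poly m p * forward_poly n q) z"
    by (simp add: poly_forward_poly power_add)
qed

lemma shift_op_forward_one: "shift_op (forward_poly N 1) y k = y (k + N)"
  by (simp add: shift_op_forward_poly if_distrib[of "\<lambda>x. x * _"] cong: if_cong)

lemma degree_mult_add_le:
  fixes p q r s :: "real poly"
  assumes "degree p \<le> n" "degree q \<le> n" "degree r \<le> n" "degree s \<le> n"
  shows "degree (p * q + r * s) \<le> 2 * n"
  using assms degree_mult_le[of p q] degree_mult_le[of r s]
  by (intro degree_add_le) linarith+

section \<open>Pole placement gains\<close>

lemma delay_poly_add: "delay_poly pos (v + w) = delay_poly pos v + delay_poly pos w"
  by (simp add: delay_poly_def sum.distrib add_monom[symmetric])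

lemma coeff_delay_poly: "coeff (delay_poly pos v) j = (\<Sum>i\<in>UNIV. if pos i = j then v $ i else 0)"
  by (simp add: delay_poly_def coeff_sum)

lemma delay_poly_scaleR: "delay_poly pos (c *\<^sub>R v) = smult c (delay_poly pos v)"
  by (rule poly_eqI) (auto simp: coeff_delay_poly sum_distrib_left intro!: sum.cong)

lemma delay_poly_uminus: "delay_poly pos (- v) = - delay_poly pos v"
  using delay_poly_scaleR[of pos "-1" v] by simp

lemma delay_poly_diff: "delay_poly pos (v - w) = delay_poly pos v - delay_poly pos w"
  using delay_poly_add[of pos v "- w"] by (simp add: delay_poly_uminus)

context
  fixes pos :: "'n::finite \<Rightarrow> nat"
  assumes numbering: "numbering pos"
begin

lemma pos_bounds: "1 \<le> pos i" "pos i \<le> CARD('n)"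
  using numbering unfolding numbering_def bij_betw_def by auto

lemma inj_pos: "inj pos"
  using numbering unfolding numbering_def bij_betw_def by blast

lemma pos_inv: "j \<in> {1..CARD('n)} \<Longrightarrow> pos (inv pos j) = j"
  using numbering unfolding numbering_def bij_betw_def by (metis f_inv_into_f)

lemma coeff_delay_poly_pos: "coeff (delay_poly pos v) (pos i) = v $ i"
proof -
  have "(\<Sum>j\<in>UNIV. if pos j = pos i then v $ j else 0) = (\<Sum>j\<in>UNIV. if j = i then v $ i else 0)"
    by (rule sum.cong) (auto dest: injD[OF inj_pos])
  then show ?thesis by (simp add: coeff_delay_poly)
qed

lemma coeff_delay_poly_0: "coeff (delay_poly pos v) 0 = 0"
  unfolding coeff_delay_poly using pos_bounds(1)
  by (intro sum.neutral) (metis not_one_le_zero)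

lemma degree_delay_poly_le: "degree (delay_poly pos v) \<le> CARD('n)"
proof (rule degree_le, intro allI impI)
  fix j assume j: "CARD('n) < j"
  have "pos i \<noteq> j" for i using pos_bounds(2)[of i] j by linarith
  then show "coeff (delay_poly pos v) j = 0" by (simp add: coeff_delay_poly)
qed

lemma forward_poly_delay_poly_eq_0_iff:
  "forward_poly CARD('n) (delay_poly pos v) = 0 \<longleftrightarrow> v = 0"
proof
  assume *: "forward_poly CARD('n) (delay_poly pos v) = 0"
  have "v $ i = 0" for i
    using arg_cong[OF *, of "\<lambda>p. coeff p (CARD('n) - pos i)"] pos_bounds(2)[of i]
    by (simp add: coeff_forward_poly coeff_delay_poly_pos)
  then show "v = 0" by (simp add: vec_eq_iff)
qed (simp add: delay_poly_def forward_poly_def)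

text \<open>A delay polynomial has constant coefficient 0, and reversal moves that coefficient to
  degree n.\<close>

lemma degree_forward_delay_poly:
  assumes "v \<noteq> 0"
  shows "degree (forward_poly CARD('n) (delay_poly pos v)) < CARD('n)"
proof -
  have "degree (forward_poly CARD('n) (delay_poly pos v)) \<noteq> CARD('n)"
  proof
    assume "degree (forward_poly CARD('n) (delay_poly pos v)) = CARD('n)"
    then have "lead_coeff (forward_poly CARD('n) (delay_poly pos v)) = 0"
      by (simp add: coeff_forward_poly coeff_delay_poly_0)
    with assms show False by (simp add: forward_poly_delay_poly_eq_0_iff)
  qed
  then show ?thesis using degree_forward_poly_le[of "CARD('n)" "delay_poly pos v"] by linarith
qed

lemma shift_op_forward_delay_poly:
  "shift_op (forward_poly CARD('n) (delay_poly pos v)) y k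
     = (\<Sum>i\<in>UNIV. v $ i * y (k + CARD('n) - pos i))"
proof -
  have "shift_op (forward_poly CARD('n) (delay_poly pos v)) y k
      = (\<Sum>j\<le>CARD('n). \<Sum>i\<in>UNIV. if pos i = j then v $ i * y (k + CARD('n) - j) else 0)"
    by (auto simp: shift_op_forward_poly coeff_delay_poly sum_distrib_right if_distrib
        intro!: sum.cong)
  also have "\<dots> = (\<Sum>i\<in>UNIV. \<Sum>j\<le>CARD('n). if pos i = j then v $ i * y (k + CARD('n) - j) else 0)"
    by (rule sum.swap)
  also have "\<dots> = (\<Sum>i\<in>UNIV. v $ i * y (k + CARD('n) - pos i))"
    using pos_bounds by (intro sum.cong) (auto simp: sum.delta)
  finally show ?thesis .
qed

text \<open>The homogeneous part of the equation A L + B P = Q; in coordinates its matrix is the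
  Sylvester matrix of A and B.\<close>

definition sylvester :: "'n param \<Rightarrow> 'n param \<Rightarrow> real poly" where
  "sylvester \<theta> x = polyA pos \<theta> * delay_poly pos (fst x) + polyB pos \<theta> * delay_poly pos (snd x)"

text \<open>Coordinates on the polynomials of degree at most 2n with constant coefficient 0. They
  turn \<open>sylvester \<theta>\<close> into an endomorphism of the parameter space, so that
  injectivity gives surjectivity.\<close>

definition read_coeffs :: "real poly \<Rightarrow> 'n param" where
  "read_coeffs p = ((\<chi> i. coeff p (pos i)), (\<chi> i. coeff p (CARD('n) + pos i)))"

lemma read_coeffs_add: "read_coeffs (p + q) = read_coeffs p + read_coeffs q"
  by (simp add: read_coeffs_def vec_eq_iff)

lemma read_coeffs_smult: "read_coeffs (smult c p) = c *\<^sub>R read_coeffs p"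
  by (simp add: read_coeffs_def vec_eq_iff)

lemma read_coeffs_diff: "read_coeffs (p - q) = read_coeffs p - read_coeffs q"
  by (simp add: read_coeffs_def vec_eq_iff)

lemma read_coeffs_uminus: "read_coeffs (- p) = - read_coeffs p"
  by (simp add: read_coeffs_def vec_eq_iff)

lemma read_coeffs_eq_0:
  assumes "read_coeffs p = 0" "coeff p 0 = 0" "degree p \<le> 2 * CARD('n)"
  shows "p = 0"
proof (rule poly_eqI)
  fix j
  have lo: "coeff p (pos i) = 0" and hi: "coeff p (CARD('n) + pos i) = 0" for i
    using assms(1) by (auto simp: read_coeffs_def vec_eq_iff zero_prod_def)
  consider "j = 0" | "j \<in> {1..CARD('n)}" | "j - CARD('n) \<in> {1..CARD('n)}" "CARD('n) < j" | "degree p < j"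
    using assms(3) by force
  then show "coeff p j = coeff 0 j"
  proof cases
    case 2
    with lo[of "inv pos j"] show ?thesis by (simp add: pos_inv)
  next
    case 3
    with hi[of "inv pos (j - CARD('n))"] show ?thesis by (simp add: pos_inv)
  qed (use assms in \<open>auto simp: coeff_eq_0\<close>)
qed

lemma degree_polyA_le: "degree (polyA pos \<theta>) \<le> CARD('n)"
  unfolding polyA_def by (rule degree_add_le) (simp_all add: degree_delay_poly_le)

lemma degree_polyB_le: "degree (polyB pos \<theta>) \<le> CARD('n)"
  unfolding polyB_def by (rule degree_delay_poly_le)

lemma coeff_polyA_0: "coeff (polyA pos \<theta>) 0 = 1"
  by (simp add: polyA_def coeff_delay_poly_0)

lemma degree_sylvester_le: "degree (sylvester \<theta> x) \<le> 2 * CARD('n)"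
  unfolding sylvester_def
  by (intro degree_mult_add_le degree_polyA_le degree_polyB_le degree_delay_poly_le)

lemma coeff_sylvester_0: "coeff (sylvester \<theta> x) 0 = 0"
  by (simp add: sylvester_def coeff_mult coeff_delay_poly_0)

text \<open>After reversal, \<open>a * l + b * p = 0\<close>. By coprimality \<open>a\<close>
  divides \<open>p\<close>; but \<open>a\<close> has degree at least n and a nonzero
  \<open>p\<close> has degree below n. Hence \<open>p = 0\<close>, and then
  \<open>l = 0\<close>.\<close>

lemma sylvester_eq_0:
  assumes cop: "coprime (forward_poly CARD('n) (polyA pos \<theta>)) (forward_poly CARD('n) (polyB pos \<theta>))"
    and "sylvester \<theta> x = 0"
  shows "x = 0"
proof -
  define a b l p where "a = forward_poly CARD('n) (polyA pos \<theta>)"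
    and "b = forward_poly CARD('n) (polyB pos \<theta>)"
    and "l = forward_poly CARD('n) (delay_poly pos (fst x))"
    and "p = forward_poly CARD('n) (delay_poly pos (snd x))"
  note abs = a_def b_def l_def p_def
  have "forward_poly (CARD('n) + CARD('n)) (sylvester \<theta> x) = 0"
    using assms by (simp add: forward_poly_def)
  then have eq: "a * l + b * p = 0"
    unfolding abs sylvester_def
    by (simp add: forward_poly_add forward_poly_mult degree_polyA_le degree_polyB_le
        degree_delay_poly_le)
  have lead: "coeff a CARD('n) = 1"
    by (simp add: abs coeff_forward_poly coeff_polyA_0)
  then have a0: "a \<noteq> 0" and dega: "CARD('n) \<le> degree a"
    by (auto intro: le_degree)
  have "b * p = a * (- l)" using eq by (simp add: eq_neg_iff_add_eq_0 add.commute)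
  then have "a dvd b * p" by simp
  then have ap: "a dvd p" using cop coprime_dvd_mult_right_iff[of a b p] by (simp add: a_def b_def)
  have "snd x = 0"
  proof (rule ccontr)
    assume "snd x \<noteq> 0"
    then have "degree p < CARD('n)" "p \<noteq> 0"
      by (simp_all add: abs degree_forward_delay_poly forward_poly_delay_poly_eq_0_iff)
    with dvd_imp_degree_le[OF ap] dega show False by simp
  qed
  then have "p = 0" by (simp add: abs forward_poly_delay_poly_eq_0_iff)
  with eq a0 have "l = 0" by simp
  with \<open>snd x = 0\<close> show ?thesis
    by (simp add: abs forward_poly_delay_poly_eq_0_iff prod_eq_iff)
qed

text \<open>The leading 1 of A gives a part free of \<theta>; the remainder, \<open>syl_bil\<close>,
  is bilinear. In finite dimension both are bounded, which yields continuity and Lipschitz estimates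
  in \<theta>.\<close>

definition syl_const :: "'n param \<Rightarrow> 'n param" where
  "syl_const x = read_coeffs (delay_poly pos (fst x))"

definition syl_bil :: "'n param \<Rightarrow> 'n param \<Rightarrow> 'n param" where
  "syl_bil \<theta> x = read_coeffs (delay_poly pos (- fst \<theta>) * delay_poly pos (fst x)
                              + delay_poly pos (snd \<theta>) * delay_poly pos (snd x))"

lemma read_coeffs_sylvester: "read_coeffs (sylvester \<theta> x) = syl_const x + syl_bil \<theta> x"
  by (simp add: syl_const_def syl_bil_def sylvester_def polyA_def polyB_def
      read_coeffs_add[symmetric] algebra_simps)

lemma bounded_linear_syl_const: "bounded_linear syl_const"
  unfolding linear_conv_bounded_linear[symmetric] syl_const_def
  by (rule linearI) (simp_all add: delay_poly_add delay_poly_scaleR read_coeffs_add read_coeffs_smult)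

lemma bounded_bilinear_syl_bil: "bounded_bilinear syl_bil"
  unfolding bilinear_conv_bounded_bilinear[symmetric] bilinear_def syl_bil_def
  by (intro conjI allI linearI)
     (simp_all add: delay_poly_add delay_poly_scaleR delay_poly_diff delay_poly_uminus
       read_coeffs_smult read_coeffs_add read_coeffs_diff read_coeffs_uminus algebra_simps)

text \<open>The minimum over \<open>S\<close> times the unit sphere is attained by compactness and
  positive by injectivity; homogeneity extends it to all \<open>x\<close>. It is a bound on the
  inverse Sylvester matrices, uniform over \<open>S\<close>.\<close>

lemma sylvester_bounded_below:
  assumes "compact S" "S \<noteq> {}"
    and "\<And>\<theta>. \<theta> \<in> S \<Longrightarrow> coprime (forward_poly CARD('n) (polyA pos \<theta>)) (forward_poly CARD('n) (polyB pos \<theta>))"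
  shows "\<exists>\<kappa>>0. \<forall>\<theta>\<in>S. \<forall>x. \<kappa> * norm x \<le> norm (syl_const x + syl_bil \<theta> x)"
proof -
  define G where "G = (\<lambda>(\<theta>, x). norm (syl_const x + syl_bil \<theta> x))"
  interpret c: bounded_linear syl_const by (rule bounded_linear_syl_const)
  interpret b: bounded_bilinear syl_bil by (rule bounded_bilinear_syl_bil)
  have "compact (S \<times> sphere (0::'n param) 1)"
    using assms by (intro compact_Times) auto
  moreover have "S \<times> sphere (0::'n param) 1 \<noteq> {}"
  proof -
    have "((axis undefined 1, 0) :: 'n param) \<in> sphere 0 1"
      by (simp add: norm_Pair)
    with assms(2) show ?thesis by blast
  qed
  moreover have "continuous_on (S \<times> sphere 0 1) G"
    unfolding G_def case_prod_unfold
    by (intro continuous_intros c.continuous_on b.continuous_on)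
  ultimately obtain m where m: "m \<in> S \<times> sphere 0 1"
    and le: "\<And>w. w \<in> S \<times> sphere 0 1 \<Longrightarrow> G m \<le> G w"
    using continuous_attains_inf[of "S \<times> sphere 0 1" G] by blast
  have "G m \<noteq> 0"
  proof
    assume "G m = 0"
    then have "read_coeffs (sylvester (fst m) (snd m)) = 0"
      by (simp add: G_def case_prod_unfold read_coeffs_sylvester)
    then have "sylvester (fst m) (snd m) = 0"
      by (rule read_coeffs_eq_0) (simp_all add: coeff_sylvester_0 degree_sylvester_le)
    then have "snd m = 0" by (rule sylvester_eq_0[rotated]) (use m assms(3) in auto)
    with m show False by auto
  qed
  then have pos: "0 < G m" by (simp add: G_def case_prod_unfold)
  have "G m * norm x \<le> norm (syl_const x + syl_bil \<theta> x)" if "\<theta> \<in> S" for \<theta> x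
  proof (cases "x = 0")
    case False
    define z where "z = x /\<^sub>R norm x"
    have x: "x = norm x *\<^sub>R z" using False by (simp add: z_def)
    have "G m \<le> G (\<theta>, z)" using le[of "(\<theta>, z)"] that False by (simp add: z_def)
    then have "norm x * G m \<le> norm x * norm (syl_const z + syl_bil \<theta> z)"
      by (simp add: G_def mult_left_mono)
    also have "\<dots> = norm (syl_const x + syl_bil \<theta> x)"
    proof -
      have "syl_const (norm x *\<^sub>R z) + syl_bil \<theta> (norm x *\<^sub>R z) = norm x *\<^sub>R (syl_const z + syl_bil \<theta> z)"
        by (simp add: c.scaleR b.scaleR_right scaleR_add_right)
      then show ?thesis unfolding x[symmetric] by simp
    qed
    finally show ?thesis by (simp add: mult.commute)
  qed (simp add: c.zero b.zero_right)
  with pos show ?thesis by blast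
qed

text \<open>The Sylvester map is an injective endomorphism, hence bijective, so the definite
  description is justified. Both Q and A have constant coefficient 1, so comparing the coefficients
  of degrees 1 to 2n decides the equation.\<close>

lemma pole_placement_spec:
  assumes cop: "coprime (forward_poly CARD('n) (polyA pos \<theta>)) (forward_poly CARD('n) (polyB pos \<theta>))"
    and Q: "coeff Q 0 = 1" "degree Q \<le> 2 * CARD('n)"
  shows "polyA pos \<theta> * (1 + delay_poly pos (gainL pos Q \<theta>))
           + polyB pos \<theta> * delay_poly pos (gainP pos Q \<theta>) = Q"
proof -
  let ?T = "\<lambda>x. read_coeffs (sylvester \<theta> x)"
  interpret c: bounded_linear syl_const by (rule bounded_linear_syl_const)
  interpret b: bounded_bilinear syl_bil by (rule bounded_bilinear_syl_bil)
  have lin: "linear ?T"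
    unfolding read_coeffs_sylvester
    by (rule linearI) (simp_all add: c.add b.add_right c.scaleR b.scaleR_right scaleR_add_right)
  have inj0: "x = 0" if "?T x = 0" for x
    by (rule sylvester_eq_0[OF cop read_coeffs_eq_0[OF that]])
       (simp_all add: coeff_sylvester_0 degree_sylvester_le)
  then have "inj ?T" using lin linear_injective_0 by blast
  then have "surj ?T" using lin linear_injective_imp_surjective by blast
  then obtain x where x: "?T x = read_coeffs (Q - polyA pos \<theta>)" by (metis surjD)
  have eqv: "polyA pos \<theta> * (1 + delay_poly pos (fst x)) + polyB pos \<theta> * delay_poly pos (snd x) = Q
    \<longleftrightarrow> ?T x = read_coeffs (Q - polyA pos \<theta>)" for x
  proof -
    have "sylvester \<theta> x - (Q - polyA pos \<theta>) = 0 \<longleftrightarrow> read_coeffs (sylvester \<theta> x - (Q - polyA pos \<theta>)) = 0"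
    proof
      assume *: "read_coeffs (sylvester \<theta> x - (Q - polyA pos \<theta>)) = 0"
      have "degree (polyA pos \<theta>) \<le> 2 * CARD('n)" using degree_polyA_le[of \<theta>] by linarith
      then have "degree (sylvester \<theta> x - (Q - polyA pos \<theta>)) \<le> 2 * CARD('n)"
        using Q degree_sylvester_le by (intro degree_diff_le) auto
      with * show "sylvester \<theta> x - (Q - polyA pos \<theta>) = 0"
        by (intro read_coeffs_eq_0) (simp_all add: coeff_sylvester_0 Q coeff_polyA_0)
    qed (simp add: read_coeffs_def zero_prod_def vec_eq_iff)
    moreover have "polyA pos \<theta> * (1 + delay_poly pos (fst x)) + polyB pos \<theta> * delay_poly pos (snd x) = Q
        \<longleftrightarrow> sylvester \<theta> x - (Q - polyA pos \<theta>) = 0"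
      by (auto simp: sylvester_def algebra_simps)
    ultimately show ?thesis by (simp add: read_coeffs_diff[of "sylvester \<theta> x"])
  qed
  have "polyA pos \<theta> * (1 + delay_poly pos (fst (pole_placement pos Q \<theta>)))
       + polyB pos \<theta> * delay_poly pos (snd (pole_placement pos Q \<theta>)) = Q"
    unfolding pole_placement_def
  proof (rule theI[of _ x])
    show "polyA pos \<theta> * (1 + delay_poly pos (fst x)) + polyB pos \<theta> * delay_poly pos (snd x) = Q"
      using x eqv by blast
    show "z = x" if "polyA pos \<theta> * (1 + delay_poly pos (fst z)) + polyB pos \<theta> * delay_poly pos (snd z) = Q" for z
      using that x eqv injD[OF \<open>inj ?T\<close>] by metis
  qed
  then show ?thesis by (simp add: gainL_def gainP_def)
qed

text \<open>Since \<open>polyA pos \<theta>\<close> is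
  \<open>1 - delay_poly pos (fst \<theta>)\<close>, the right-hand side Q - A is affine in
  \<theta>.\<close>

lemma gain_equation:
  assumes "coprime (forward_poly CARD('n) (polyA pos \<theta>)) (forward_poly CARD('n) (polyB pos \<theta>))"
    and "coeff Q 0 = 1" "degree Q \<le> 2 * CARD('n)"
  defines "g \<equiv> pole_placement pos Q \<theta>"
  shows "syl_const g + syl_bil \<theta> g = read_coeffs (Q - 1) + syl_const \<theta>"
proof -
  have "sylvester \<theta> g = (Q - 1) + delay_poly pos (fst \<theta>)"
    using pole_placement_spec[OF assms(1-3)]
    by (auto simp: sylvester_def g_def gainL_def gainP_def polyA_def delay_poly_uminus algebra_simps)
  then have "read_coeffs (sylvester \<theta> g) = read_coeffs ((Q - 1) + delay_poly pos (fst \<theta>))" by simp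
  then show ?thesis by (simp only: read_coeffs_sylvester read_coeffs_add syl_const_def)
qed

text \<open>The gains solve a linear system whose matrix is uniformly bounded below and whose data
  are affine in \<theta>. Dividing by \<kappa> bounds the solution, and then the difference of two
  solutions.\<close>

lemma pole_placement_bounded_Lipschitz:
  assumes S: "compact S" "S \<noteq> {}"
    and cop: "\<And>\<theta>. \<theta> \<in> S \<Longrightarrow> coprime (forward_poly CARD('n) (polyA pos \<theta>)) (forward_poly CARD('n) (polyB pos \<theta>))"
    and Q: "coeff Q 0 = 1" "degree Q \<le> 2 * CARD('n)"
  shows "\<exists>B L. 0 \<le> B \<and> 0 \<le> L \<and> (\<forall>\<theta>\<in>S. norm (pole_placement pos Q \<theta>) \<le> B) \<and>
    (\<forall>\<theta>\<in>S. \<forall>\<theta>'\<in>S. norm (pole_placement pos Q \<theta> - pole_placement pos Q \<theta>') \<le> L * norm (\<theta> - \<theta>'))"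
proof -
  interpret c: bounded_linear syl_const by (rule bounded_linear_syl_const)
  interpret b: bounded_bilinear syl_bil by (rule bounded_bilinear_syl_bil)
  obtain \<kappa> where \<kappa>: "0 < \<kappa>"
    and below: "\<And>\<theta> x. \<theta> \<in> S \<Longrightarrow> \<kappa> * norm x \<le> norm (syl_const x + syl_bil \<theta> x)"
    using sylvester_bounded_below[OF S cop] by blast
  obtain R where R: "\<And>\<theta>. \<theta> \<in> S \<Longrightarrow> norm \<theta> \<le> R"
    using compact_imp_bounded[OF S(1)] by (auto simp: bounded_iff)
  obtain Kc where Kc: "0 \<le> Kc" "\<And>x. norm (syl_const x) \<le> norm x * Kc"
    using c.nonneg_bounded by blast
  obtain Kb where Kb: "0 \<le> Kb" "\<And>x y. norm (syl_bil x y) \<le> norm x * norm y * Kb"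
    using b.nonneg_bounded by blast
  let ?g = "pole_placement pos Q"
  define B where "B = (norm (read_coeffs (Q - 1)) + R * Kc) / \<kappa>"
  have gB: "norm (?g \<theta>) \<le> B" if "\<theta> \<in> S" for \<theta>
  proof -
    have "\<kappa> * norm (?g \<theta>) \<le> norm (read_coeffs (Q - 1) + syl_const \<theta>)"
      using below[OF that, of "?g \<theta>"] gain_equation[OF cop[OF that] Q] by simp
    also have "\<dots> \<le> norm (read_coeffs (Q - 1)) + R * Kc"
      using Kc(2)[of \<theta>] mult_right_mono[OF R[OF that] Kc(1)]
      by (intro norm_triangle_le) linarith
    finally show ?thesis using \<kappa> by (simp add: B_def field_simps)
  qed
  have B0: "0 \<le> B" using gB S(2) norm_ge_zero order_trans by blast
  define L where "L = (Kc + B * Kb) / \<kappa>"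
  have gL: "norm (?g \<theta> - ?g \<theta>') \<le> L * norm (\<theta> - \<theta>')" if "\<theta> \<in> S" "\<theta>' \<in> S" for \<theta> \<theta>'
  proof -
    have e: "syl_const (?g \<theta>) + syl_bil \<theta> (?g \<theta>) = read_coeffs (Q - 1) + syl_const \<theta>"
            "syl_const (?g \<theta>') + syl_bil \<theta>' (?g \<theta>') = read_coeffs (Q - 1) + syl_const \<theta>'"
      using gain_equation[OF cop Q] that by auto
    \<comment> \<open>The difference of the gains is put under the operator at \<theta>; the
      mismatch of the operators then falls on \<open>?g \<theta>'\<close>, which is already
      bounded.\<close>
    have "syl_const (?g \<theta> - ?g \<theta>') + syl_bil \<theta> (?g \<theta> - ?g \<theta>')
        = (syl_const (?g \<theta>) + syl_bil \<theta> (?g \<theta>)) - (syl_const (?g \<theta>') + syl_bil \<theta>' (?g \<theta>'))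
          + syl_bil (\<theta>' - \<theta>) (?g \<theta>')"
      by (simp add: c.diff b.diff_right b.diff_left)
    also have "\<dots> = syl_const (\<theta> - \<theta>') + syl_bil (\<theta>' - \<theta>) (?g \<theta>')"
      unfolding e by (simp add: c.diff)
    finally have "\<kappa> * norm (?g \<theta> - ?g \<theta>') \<le> norm (syl_const (\<theta> - \<theta>') + syl_bil (\<theta>' - \<theta>) (?g \<theta>'))"
      using below[OF that(1), of "?g \<theta> - ?g \<theta>'"] by simp
    also have "\<dots> \<le> norm (\<theta> - \<theta>') * Kc + norm (\<theta>' - \<theta>) * norm (?g \<theta>') * Kb"
      using Kc(2) Kb(2) by (intro norm_triangle_le add_mono)
    also have "\<dots> \<le> norm (\<theta> - \<theta>') * Kc + norm (\<theta> - \<theta>') * B * Kb"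
      using gB[OF that(2)] Kb(1)
      by (auto simp: norm_minus_commute intro!: add_left_mono mult_right_mono mult_left_mono)
    finally show ?thesis using \<kappa> by (simp add: L_def field_simps)
  qed
  have "0 \<le> L" using B0 Kb Kc \<kappa> by (simp add: L_def)
  with B0 gB gL show ?thesis by blast
qed

end

section \<open>The frozen closed loop\<close>

lemma norm_prod_swap: "norm (prod.swap x) = norm (x :: 'a::real_normed_vector \<times> 'a)"
  by (cases x) (simp add: norm_Pair add.commute)

lemma norm_le_components:
  fixes x :: "'n::finite param"
  assumes "\<And>i. \<bar>fst x $ i\<bar> \<le> B" "\<And>i. \<bar>snd x $ i\<bar> \<le> B"
  shows "norm x \<le> 2 * real CARD('n) * B"
proof -
  have "norm x \<le> norm (fst x) + norm (snd x)" by (metis norm_Pair_le prod.collapse)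
  also have "\<dots> \<le> (\<Sum>i\<in>UNIV. \<bar>fst x $ i\<bar>) + (\<Sum>i\<in>UNIV. \<bar>snd x $ i\<bar>)"
    by (intro add_mono norm_le_l1_cart)
  also have "\<dots> \<le> (\<Sum>i\<in>(UNIV::'n set). B) + (\<Sum>i\<in>(UNIV::'n set). B)"
    using assms by (intro add_mono sum_mono)
  finally show ?thesis by (simp add: mult_ac)
qed

context
  fixes pos :: "'n::finite \<Rightarrow> nat"
  assumes numbering: "numbering pos"
begin

text \<open>The delay lines without new data: the entries numbered 1 are left 0, to be filled along
  \<open>unit_y\<close> and \<open>unit_u\<close>.\<close>

definition shift_regressor :: "'n param \<Rightarrow> 'n param" where
  "shift_regressor \<phi> =
     ((\<chi> i. if pos i = 1 then 0 else fst \<phi> $ inv pos (pos i - 1)),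
      (\<chi> i. if pos i = 1 then 0 else snd \<phi> $ inv pos (pos i - 1)))"

definition unit_y :: "'n param" where "unit_y = (axis (inv pos 1) 1, 0)"

definition unit_u :: "'n param" where "unit_u = (0, axis (inv pos 1) 1)"

lemma pos_inv_1: "pos (inv pos 1) = 1"
  by (rule pos_inv[OF numbering]) (simp add: Suc_leI)

lemma pos_eq_1_iff: "pos i = 1 \<longleftrightarrow> i = inv pos 1"
  using pos_inv_1 injD[OF inj_pos[OF numbering]] by metis

lemma norm_unit_y [simp]: "norm unit_y = 1" by (simp add: unit_y_def norm_Pair)

lemma norm_unit_u [simp]: "norm unit_u = 1" by (simp add: unit_u_def norm_Pair)

lemma regressor_Suc:
  "regressor pos y u (t + 1) = shift_regressor (regressor pos y u t) + y (t + 1) *\<^sub>R unit_y + u (t + 1) *\<^sub>R unit_u"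
proof -
  have pred: "int (pos (inv pos (pos i - 1))) = int (pos i) - 1" if "pos i \<noteq> 1" for i
  proof -
    have "pos i - 1 \<in> {1..CARD('n)}" using pos_bounds[OF numbering, of i] that by auto
    from pos_inv[OF numbering this] show ?thesis
      using pos_bounds(1)[OF numbering, of i] by simp
  qed
  have arg: "t + 1 - int (pos i) + 1 = t - int (pos (inv pos (pos i - 1))) + 1" if "pos i \<noteq> 1" for i
    using pred[OF that] by linarith
  have axis: "axis (inv pos 1) (1::real) $ i = (if pos i = 1 then 1 else 0)" for i
    using pos_eq_1_iff[of i] by (simp add: axis_def)
  let ?r = "shift_regressor (regressor pos y u t) + y (t + 1) *\<^sub>R unit_y + u (t + 1) *\<^sub>R unit_u"
  note defs = regressor_def shift_regressor_def unit_y_def unit_u_def axis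
  have "fst (regressor pos y u (t + 1)) $ i = fst ?r $ i \<and> snd (regressor pos y u (t + 1)) $ i = snd ?r $ i" for i
  proof (cases "pos i = 1")
    case True
    then show ?thesis by (simp add: defs add.commute del: One_nat_def)
  next
    case False
    have "fst (regressor pos y u (t + 1)) $ i = y (t - int (pos (inv pos (pos i - 1))) + 1)"
      and "snd (regressor pos y u (t + 1)) $ i = u (t - int (pos (inv pos (pos i - 1))) + 1)"
      unfolding arg[OF False, symmetric] by (simp_all add: regressor_def)
    moreover have "fst ?r $ i = y (t - int (pos (inv pos (pos i - 1))) + 1)"
      and "snd ?r $ i = u (t - int (pos (inv pos (pos i - 1))) + 1)"
      using False by (simp_all add: defs del: One_nat_def)
    ultimately show ?thesis by simp
  qed
  then show ?thesis by (simp add: prod_eq_iff vec_eq_iff)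
qed

text \<open>The swap is needed because a regressor lists outputs before inputs, whereas
  \<open>pole_placement\<close> returns the gains \<open>l\<close> of the inputs before the gains
  \<open>p\<close> of the outputs.\<close>

definition frozen_loop :: "real poly \<Rightarrow> 'n param \<Rightarrow> 'n param \<Rightarrow> 'n param" where
  "frozen_loop Q \<theta> \<phi> = shift_regressor \<phi> + (\<phi> \<bullet> \<theta>) *\<^sub>R unit_y
     - (\<phi> \<bullet> prod.swap (pole_placement pos Q \<theta>)) *\<^sub>R unit_u"

lemma linear_shift_regressor: "linear shift_regressor"
  by (rule linearI) (auto simp: shift_regressor_def vec_eq_iff)

lemma linear_frozen_loop: "linear (frozen_loop Q \<theta>)"
  unfolding frozen_loop_def
  by (rule linearI)
     (simp_all add: linear_add[OF linear_shift_regressor] linear_scale[OF linear_shift_regressor]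
       inner_add_left scaleR_add_left algebra_simps)

text \<open>Every step moves an entry one place down its delay line; only place 1 is
  overwritten.\<close>

lemma frozen_loop_shift:
  assumes "pos i = pos j + m"
  shows "fst ((frozen_loop Q \<theta> ^^ (k + m)) \<phi>) $ i = fst ((frozen_loop Q \<theta> ^^ k) \<phi>) $ j"
    and "snd ((frozen_loop Q \<theta> ^^ (k + m)) \<phi>) $ i = snd ((frozen_loop Q \<theta> ^^ k) \<phi>) $ j"
proof -
  have "fst ((frozen_loop Q \<theta> ^^ (k + m)) \<phi>) $ i = fst ((frozen_loop Q \<theta> ^^ k) \<phi>) $ j \<and>
        snd ((frozen_loop Q \<theta> ^^ (k + m)) \<phi>) $ i = snd ((frozen_loop Q \<theta> ^^ k) \<phi>) $ j"
    using assms
  proof (induction m arbitrary: i)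
    case 0
    then have "i = j" using injD[OF inj_pos[OF numbering]] by simp
    then show ?case by simp
  next
    case (Suc m)
    have "pos i \<noteq> 1" and ne: "i \<noteq> inv pos 1"
      using Suc.prems pos_bounds[OF numbering, of j] pos_eq_1_iff[of i] by auto
    have "pos (inv pos (pos i - 1)) = pos j + m"
      using pos_inv[OF numbering, of "pos i - 1"] pos_bounds[OF numbering, of i]
        pos_bounds[OF numbering, of j] Suc.prems by auto
    from Suc.IH[OF this] show ?case
      using \<open>pos i \<noteq> 1\<close> ne
      by (simp add: frozen_loop_def shift_regressor_def unit_y_def unit_u_def axis_def)
  qed
  then show "fst ((frozen_loop Q \<theta> ^^ (k + m)) \<phi>) $ i = fst ((frozen_loop Q \<theta> ^^ k) \<phi>) $ j"
    and "snd ((frozen_loop Q \<theta> ^^ (k + m)) \<phi>) $ i = snd ((frozen_loop Q \<theta> ^^ k) \<phi>) $ j"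
    by blast+
qed

text \<open>
  Reading off the \<^emph>\<open>oldest\<close> entries of the frozen trajectory yields output and input sequences
  on \<^typ>\<open>nat\<close> without a separate treatment of the initial values.
\<close>

lemma frozen_loop_char_recurrence:
  fixes \<phi> :: "'n param"
  assumes cop: "coprime (forward_poly CARD('n) (polyA pos \<theta>)) (forward_poly CARD('n) (polyB pos \<theta>))"
    and Q: "coeff Q 0 = 1" "degree Q \<le> 2 * CARD('n)"
  defines "x \<equiv> \<lambda>k. (frozen_loop Q \<theta> ^^ k) \<phi>"
  defines "y \<equiv> \<lambda>k. fst (x k) $ inv pos CARD('n)"
  defines "u \<equiv> \<lambda>k. snd (x k) $ inv pos CARD('n)"
  shows "fst (x k) $ i = y (k + CARD('n) - pos i)" and "snd (x k) $ i = u (k + CARD('n) - pos i)"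
    and "shift_op (forward_poly (2 * CARD('n)) Q) y k = 0"
    and "shift_op (forward_poly (2 * CARD('n)) Q) u k = 0"
proof -
  have last: "pos (inv pos CARD('n)) = CARD('n)"
    by (rule pos_inv[OF numbering]) (simp add: Suc_leI)
  have xy: "fst (x k) $ i = y (k + CARD('n) - pos i)"
    and xu: "snd (x k) $ i = u (k + CARD('n) - pos i)" for k i
  proof -
    have *: "pos (inv pos CARD('n)) = pos i + (CARD('n) - pos i)"
      using last pos_bounds(2)[OF numbering, of i] by simp
    have "k + (CARD('n) - pos i) = k + CARD('n) - pos i"
      using pos_bounds(2)[OF numbering, of i] by simp
    with frozen_loop_shift[OF *, where Q = Q and \<theta> = \<theta> and k = k and \<phi> = \<phi>]
    show "fst (x k) $ i = y (k + CARD('n) - pos i)" "snd (x k) $ i = u (k + CARD('n) - pos i)"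
      unfolding x_def y_def u_def by simp_all
  qed
  show "fst (x k) $ i = y (k + CARD('n) - pos i)" "snd (x k) $ i = u (k + CARD('n) - pos i)"
    by (fact xy xu)+
  define a b l p where "a = forward_poly CARD('n) (polyA pos \<theta>)"
    and "b = forward_poly CARD('n) (polyB pos \<theta>)"
    and "l = forward_poly CARD('n) (1 + delay_poly pos (gainL pos Q \<theta>))"
    and "p = forward_poly CARD('n) (delay_poly pos (gainP pos Q \<theta>))"
  note abs = a_def b_def l_def p_def
  have degl: "degree (1 + delay_poly pos (gainL pos Q \<theta>)) \<le> CARD('n)"
    by (rule degree_add_le) (simp_all add: degree_delay_poly_le[OF numbering])
  have "Q = polyA pos \<theta> * (1 + delay_poly pos (gainL pos Q \<theta>)) + polyB pos \<theta> * delay_poly pos (gainP pos Q \<theta>)"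
    using pole_placement_spec[OF numbering cop Q] by simp
  then have chi: "forward_poly (2 * CARD('n)) Q = a * l + b * p"
    using forward_poly_mult[OF degree_polyA_le[OF numbering] degl]
      forward_poly_mult[OF degree_polyB_le[OF numbering] degree_delay_poly_le[OF numbering]]
    by (metis abs forward_poly_add mult_2)
  have x_Suc: "x (Suc k) = frozen_loop Q \<theta> (x k)" for k by (simp add: x_def)
  \<comment> \<open>The newest entry of step \<open>Suc k\<close> has number 1, hence index
    \<open>Suc k + n - 1 = k + n\<close> in the sequence of oldest entries. The same holds for
    \<open>u_new\<close>.\<close>
  have y_new: "y (k + CARD('n)) = x k \<bullet> \<theta>" for k
    using xy[of "Suc k" "inv pos 1"] pos_inv_1
    by (simp add: x_Suc frozen_loop_def shift_regressor_def unit_y_def unit_u_def)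
  have u_new: "u (k + CARD('n)) = - (x k \<bullet> prod.swap (pole_placement pos Q \<theta>))" for k
    using xu[of "Suc k" "inv pos 1"] pos_inv_1
    by (simp add: x_Suc frozen_loop_def shift_regressor_def unit_y_def unit_u_def)
  have ay: "shift_op a y = shift_op b u"
  proof
    fix k
    show "shift_op a y k = shift_op b u k"
      using y_new[of k]
      by (simp add: abs polyA_def polyB_def forward_poly_add shift_op_add shift_op_forward_one
          shift_op_forward_delay_poly[OF numbering] inner_prod_def inner_vec_def xy xu
          sum_negf mult.commute)
  qed
  have lu: "shift_op l u k + shift_op p y k = 0" for k
    using u_new[of k]
    by (simp add: abs forward_poly_add shift_op_add shift_op_forward_one
        shift_op_forward_delay_poly[OF numbering] inner_prod_def inner_vec_def xy xu
        gainL_def gainP_def sum_negf mult.commute)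
  have mult: "shift_op (p * q) f = shift_op p (shift_op q f)" for p q :: "real poly" and f
    by (rule ext) (rule shift_op_mult)
  have zero: "shift_op q (\<lambda>k. shift_op l u k + shift_op p y k) k = 0" for q
    by (simp add: lu) (simp add: shift_op_def)
  \<comment> \<open>Elimination using A y = B u and L u + P y = 0: applied to \<open>y\<close>,
    \<open>l * a\<close> becomes \<open>b * l\<close> applied to \<open>u\<close>, so the sum is
    \<open>b\<close> applied to the zero sequence. The argument for \<open>u\<close> is
    symmetric.\<close>
  have "shift_op (a * l + b * p) y k = shift_op (l * a) y k + shift_op (b * p) y k"
    by (simp only: shift_op_add mult.commute)
  also have "shift_op (l * a) y k = shift_op (b * l) u k"
    by (metis ay mult mult.commute)
  also have "shift_op (b * l) u k + shift_op (b * p) y k = 0"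
    using zero[of b] by (simp only: shift_op_arg_add mult)
  finally show "shift_op (forward_poly (2 * CARD('n)) Q) y k = 0" by (simp only: chi)
  have "shift_op (a * l + b * p) u k = shift_op (a * l) u k + shift_op (p * b) u k"
    by (simp only: shift_op_add mult.commute)
  also have "shift_op (p * b) u k = shift_op (a * p) y k"
    by (metis ay mult mult.commute)
  also have "shift_op (a * l) u k + shift_op (a * p) y k = 0"
    using zero[of a] by (simp only: shift_op_arg_add mult)
  finally show "shift_op (forward_poly (2 * CARD('n)) Q) u k = 0" by (simp only: chi)
qed

text \<open>Each state entry is a value of one of two scalar sequences annihilated by
  \<open>chi\<close>, which does not depend on \<theta>. The decay constant of \<open>chi\<close>
  therefore serves all of \<open>S\<close>; \<theta> enters only through the first 2n values, for
  which the crude growth bound \<open>K\<close> suffices.\<close>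

lemma frozen_loop_power_bound:
  assumes cop: "\<And>\<theta>. \<theta> \<in> S \<Longrightarrow> coprime (forward_poly CARD('n) (polyA pos \<theta>)) (forward_poly CARD('n) (polyB pos \<theta>))"
    and Q: "coeff Q 0 = 1" "degree Q \<le> 2 * CARD('n)"
    and roots: "\<And>z::complex. poly (map_poly of_real (forward_poly (2 * CARD('n)) Q)) z = 0 \<Longrightarrow> cmod z < lam"
    and lam: "0 < lam" "lam < 1"
    and K: "\<And>\<theta> x. \<theta> \<in> S \<Longrightarrow> norm (frozen_loop Q \<theta> x) \<le> K * norm x" "1 \<le> K"
  shows "\<exists>\<gamma>\<ge>0. \<forall>\<theta>\<in>S. \<forall>k x. norm ((frozen_loop Q \<theta> ^^ k) x) \<le> \<gamma> * lam ^ k * norm x"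
proof -
  define chi where "chi = forward_poly (2 * CARD('n)) Q"
  define P :: "complex poly" where "P = map_poly of_real chi"
  have degP: "degree P \<le> 2 * CARD('n)"
    unfolding P_def chi_def by (rule degree_le) (simp add: coeff_map_poly coeff_forward_poly)
  have "coeff chi (2 * CARD('n)) = 1" using Q by (simp add: chi_def coeff_forward_poly)
  then have "coeff P (2 * CARD('n)) = 1" by (simp add: P_def coeff_map_poly)
  then have P0: "P \<noteq> 0" by auto
  obtain \<gamma> where \<gamma>: "\<And>y M k. (\<forall>k. cmod (shift_op P y k) \<le> M * lam ^ k) \<Longrightarrow>
        (\<forall>i<degree P. cmod (y i) \<le> M) \<Longrightarrow> cmod (y k) \<le> \<gamma> * M * lam ^ k"
    using shift_op_decay[OF P0 lam(1)] roots unfolding P_def chi_def by blast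
  have decay: "\<bar>y k\<bar> \<le> \<bar>\<gamma>\<bar> * M * lam ^ k"
    if "\<And>k. shift_op chi y k = 0" "\<And>i. i < 2 * CARD('n) \<Longrightarrow> \<bar>y i\<bar> \<le> M" "0 \<le> M" for y :: "nat \<Rightarrow> real" and M k
  proof -
    have "cmod (of_real (y k)) \<le> \<gamma> * M * lam ^ k"
      by (rule \<gamma>) (use that degP lam in \<open>auto simp: P_def shift_op_map_poly_of_real\<close>)
    also have "\<dots> \<le> \<bar>\<gamma>\<bar> * M * lam ^ k"
      using that lam by (intro mult_right_mono) auto
    finally show ?thesis by simp
  qed
  define \<gamma>' where "\<gamma>' = 2 * real CARD('n) * (\<bar>\<gamma>\<bar> * K ^ (2 * CARD('n)))"
  have "norm ((frozen_loop Q \<theta> ^^ k) \<phi>) \<le> \<gamma>' * lam ^ k * norm \<phi>" if \<theta>: "\<theta> \<in> S" for \<theta> k \<phi>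
  proof -
    define x where "x = (\<lambda>k. (frozen_loop Q \<theta> ^^ k) \<phi>)"
    define y where "y = (\<lambda>k. fst (x k) $ inv pos CARD('n))"
    define u where "u = (\<lambda>k. snd (x k) $ inv pos CARD('n))"
    define M where "M = K ^ (2 * CARD('n)) * norm \<phi>"
    have rec: "fst (x k) $ i = y (k + CARD('n) - pos i)" "snd (x k) $ i = u (k + CARD('n) - pos i)"
      "shift_op chi y k = 0" "shift_op chi u k = 0" for k i
      unfolding x_def y_def u_def chi_def by (rule frozen_loop_char_recurrence[OF cop[OF \<theta>] Q])+
    have M0: "0 \<le> M" using K by (simp add: M_def)
    have xi: "norm (x i) \<le> K ^ i * norm \<phi>" for i
    proof (induction i)
      case (Suc i)
      have "norm (x (Suc i)) \<le> K * norm (x i)" using K(1)[OF \<theta>] by (simp add: x_def)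
      also have "\<dots> \<le> K * (K ^ i * norm \<phi>)" using Suc K(2) by (intro mult_left_mono) auto
      finally show ?case by (simp add: mult_ac)
    qed (simp add: x_def)
    have xM: "norm (x i) \<le> M" if "i < 2 * CARD('n)" for i
    proof -
      have "K ^ i \<le> K ^ (2 * CARD('n))" using that K(2) by (intro power_increasing) auto
      then show ?thesis using xi[of i] unfolding M_def by (meson mult_right_mono norm_ge_zero order_trans)
    qed
    have yM: "\<bar>y i\<bar> \<le> M" "\<bar>u i\<bar> \<le> M" if "i < 2 * CARD('n)" for i
      using xM[OF that] component_le_norm_cart[of "fst (x i)"] component_le_norm_cart[of "snd (x i)"]
        norm_fst_le[of "fst (x i)" "snd (x i)"] norm_snd_le[of "snd (x i)" "fst (x i)"]
      unfolding y_def u_def by (metis order_trans prod.collapse)+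
    \<comment> \<open>The entries of \<open>x k\<close> have indices at least \<open>k\<close>, and
      \<open>lam < 1\<close> makes the extra exponent harmless.\<close>
    have pw: "\<bar>\<gamma>\<bar> * M * lam ^ (k + CARD('n) - pos i) \<le> \<bar>\<gamma>\<bar> * M * lam ^ k" for i
      using pos_bounds(2)[OF numbering, of i] lam M0 by (intro mult_left_mono power_decreasing) auto
    have "norm (x k) \<le> 2 * real CARD('n) * (\<bar>\<gamma>\<bar> * M * lam ^ k)"
    proof (rule norm_le_components)
      fix i
      show "\<bar>fst (x k) $ i\<bar> \<le> \<bar>\<gamma>\<bar> * M * lam ^ k"
        unfolding rec(1) by (rule order_trans[OF decay pw]) (use rec yM M0 in auto)
      show "\<bar>snd (x k) $ i\<bar> \<le> \<bar>\<gamma>\<bar> * M * lam ^ k"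
        unfolding rec(2) by (rule order_trans[OF decay pw]) (use rec yM M0 in auto)
    qed
    then show ?thesis by (simp add: x_def M_def \<gamma>'_def mult_ac)
  qed
  moreover have "0 \<le> \<gamma>'" using K(2) by (simp add: \<gamma>'_def)
  ultimately show ?thesis by blast
qed

text \<open>The reversed target polynomial has leading coefficient 1 in degree 2n > 0, so the
  \<open>Max\<close> runs over a finite nonempty set.\<close>

lemma root_radius_properties:
  assumes "target_poly (2 * CARD('n)) Q"
  shows "0 \<le> root_radius (2 * CARD('n)) Q"
    and "poly (map_poly of_real (forward_poly (2 * CARD('n)) Q)) z = 0 \<Longrightarrow> cmod z \<le> root_radius (2 * CARD('n)) Q"
proof -
  define P :: "complex poly" where "P = map_poly of_real (forward_poly (2 * CARD('n)) Q)"
  have "coeff P (2 * CARD('n)) = 1"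
    using assms by (simp add: P_def coeff_map_poly coeff_forward_poly target_poly_def)
  then have P0: "P \<noteq> 0" and "2 * CARD('n) \<le> degree P" by (auto intro: le_degree)
  moreover have "0 < CARD('n)" by simp
  ultimately have "degree P \<noteq> 0" by linarith
  then obtain z0 where z0: "poly P z0 = 0"
    using fundamental_theorem_of_algebra[of P] by (auto simp: constant_degree)
  have fin: "finite (cmod ` {z. poly P z = 0})" using P0 poly_roots_finite by blast
  have le: "cmod z \<le> root_radius (2 * CARD('n)) Q" if "poly P z = 0" for z
    unfolding root_radius_def P_def[symmetric] using that by (intro Max_ge[OF fin]) auto
  show "0 \<le> root_radius (2 * CARD('n)) Q" using le[OF z0] norm_ge_zero order_trans by blast
  show "poly (map_poly of_real (forward_poly (2 * CARD('n)) Q)) z = 0 \<Longrightarrow> cmod z \<le> root_radius (2 * CARD('n)) Q"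
    using le by (simp add: P_def)
qed

text \<open>Parameter and gains enter the loop map linearly through inner products with the state,
  so bounds and Lipschitz constants of the gains carry over to the map.\<close>

lemma frozen_loop_uniform:
  assumes S: "parameter_set pos S" and Q: "target_poly (2 * CARD('n)) Q"
    and lam: "root_radius (2 * CARD('n)) Q < lam" "lam < 1"
  shows "\<exists>\<gamma> L. 0 \<le> \<gamma> \<and> 0 \<le> L \<and>
    (\<forall>\<theta>\<in>S. \<forall>k x. norm ((frozen_loop Q \<theta> ^^ k) x) \<le> \<gamma> * lam ^ k * norm x) \<and>
    (\<forall>\<theta>\<in>S. \<forall>\<theta>'\<in>S. \<forall>x. norm (frozen_loop Q \<theta> x - frozen_loop Q \<theta>' x) \<le> L * norm (\<theta> - \<theta>') * norm x)"
proof -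
  have cop: "\<And>\<theta>. \<theta> \<in> S \<Longrightarrow> coprime (forward_poly CARD('n) (polyA pos \<theta>)) (forward_poly CARD('n) (polyB pos \<theta>))"
    and ne: "S \<noteq> {}" and comp: "compact S"
    using S by (auto simp: parameter_set_def)
  have Q': "coeff Q 0 = 1" "degree Q \<le> 2 * CARD('n)" using Q by (auto simp: target_poly_def)
  let ?g = "\<lambda>\<theta>. prod.swap (pole_placement pos Q \<theta>)"
  obtain B L where BL: "0 \<le> B" "0 \<le> L" and gB: "\<And>\<theta>. \<theta> \<in> S \<Longrightarrow> norm (?g \<theta>) \<le> B"
    and gL: "\<And>\<theta> \<theta>'. \<theta> \<in> S \<Longrightarrow> \<theta>' \<in> S \<Longrightarrow> norm (?g \<theta> - ?g \<theta>') \<le> L * norm (\<theta> - \<theta>')"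
  proof -
    have sw: "prod.swap x - prod.swap y = prod.swap (x - y)" for x y :: "'n param"
      by (simp add: prod_eq_iff)
    show ?thesis
      using pole_placement_bounded_Lipschitz[OF numbering comp ne cop Q'] that
      unfolding sw norm_prod_swap by blast
  qed
  obtain R where R: "\<And>\<theta>. \<theta> \<in> S \<Longrightarrow> norm \<theta> \<le> R"
    using compact_imp_bounded[OF comp] by (auto simp: bounded_iff)
  have R0: "0 \<le> R" using R ne norm_ge_zero order_trans by blast
  obtain K0 where K0: "0 \<le> K0" "\<And>x. norm (shift_regressor x) \<le> norm x * K0"
    using linear_shift_regressor bounded_linear.nonneg_bounded linear_conv_bounded_linear by blast
  have inner_le: "\<bar>x \<bullet> v\<bar> \<le> norm x * c" if "norm v \<le> c" for x v :: "'n param" and c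
    using Cauchy_Schwarz_ineq2[of x v] mult_left_mono[OF that norm_ge_zero[of x]] by linarith
  have tri: "norm (a + b - c) \<le> norm a + norm b + norm c" for a b c :: "'n param"
    using norm_triangle_ineq4[of "a + b" c] norm_triangle_ineq[of a b] by linarith
  define K where "K = K0 + R + B + 1"
  have K: "norm (frozen_loop Q \<theta> x) \<le> K * norm x" if "\<theta> \<in> S" for \<theta> x
  proof -
    have "norm (frozen_loop Q \<theta> x) \<le> norm (shift_regressor x) + \<bar>x \<bullet> \<theta>\<bar> + \<bar>x \<bullet> ?g \<theta>\<bar>"
      using tri[of "shift_regressor x" "(x \<bullet> \<theta>) *\<^sub>R unit_y" "(x \<bullet> ?g \<theta>) *\<^sub>R unit_u"]
      by (simp add: frozen_loop_def)
    also have "\<dots> \<le> norm x * K0 + norm x * R + norm x * B"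
      using K0 inner_le R that gB by (intro add_mono) auto
    also have "\<dots> \<le> K * norm x" by (simp add: K_def algebra_simps)
    finally show ?thesis .
  qed
  have "1 \<le> K" using K0 R0 BL by (simp add: K_def)
  have rr: "0 \<le> root_radius (2 * CARD('n)) Q" by (rule root_radius_properties(1)[OF Q])
  have "\<exists>\<gamma>\<ge>0. \<forall>\<theta>\<in>S. \<forall>k x. norm ((frozen_loop Q \<theta> ^^ k) x) \<le> \<gamma> * lam ^ k * norm x"
    using lam rr root_radius_properties(2)[OF Q] K \<open>1 \<le> K\<close>
    by (intro frozen_loop_power_bound[OF cop Q']) (auto intro: le_less_trans)
  then obtain \<gamma> where \<gamma>: "0 \<le> \<gamma>" "\<forall>\<theta>\<in>S. \<forall>k x. norm ((frozen_loop Q \<theta> ^^ k) x) \<le> \<gamma> * lam ^ k * norm x"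
    by blast
  have "norm (frozen_loop Q \<theta> x - frozen_loop Q \<theta>' x) \<le> (1 + L) * norm (\<theta> - \<theta>') * norm x"
    if "\<theta> \<in> S" "\<theta>' \<in> S" for \<theta> \<theta>' x
  proof -
    have "frozen_loop Q \<theta> x - frozen_loop Q \<theta>' x
        = (x \<bullet> (\<theta> - \<theta>')) *\<^sub>R unit_y - (x \<bullet> (?g \<theta> - ?g \<theta>')) *\<^sub>R unit_u"
      by (simp add: frozen_loop_def inner_diff_right algebra_simps)
    then have "norm (frozen_loop Q \<theta> x - frozen_loop Q \<theta>' x) \<le> \<bar>x \<bullet> (\<theta> - \<theta>')\<bar> + \<bar>x \<bullet> (?g \<theta> - ?g \<theta>')\<bar>"
      by (metis norm_triangle_ineq4 norm_scaleR norm_unit_y norm_unit_u mult.right_neutral)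
    also have "\<dots> \<le> norm x * norm (\<theta> - \<theta>') + norm x * (L * norm (\<theta> - \<theta>'))"
      by (intro add_mono inner_le gL that order_refl)
    finally show ?thesis by (simp add: algebra_simps)
  qed
  with \<gamma> BL show ?thesis by (intro exI[of _ \<gamma>] exI[of _ "1 + L"]) auto
qed

end

section \<open>Slowly varying systems\<close>

lemma power_times_n_bounded:
  fixes q :: real
  assumes "0 \<le> q" "q < 1"
  shows "\<exists>C\<ge>0. \<forall>k. real k * q ^ k \<le> C"
proof -
  have "(\<lambda>n. real n * q ^ n) \<longlonglongrightarrow> 0"
    using powser_times_n_limit_0[of q] assms by simp
  then have "Bseq (\<lambda>n. real n * q ^ n)" by (intro convergent_imp_Bseq) (auto simp: convergent_def)
  then obtain C where "0 < C" "\<And>n. norm (real n * q ^ n) \<le> C" by (auto elim: BseqE)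
  then show ?thesis by (intro exI[of _ C]) (auto dest: meta_spec simp: abs_le_iff intro: order_trans[OF abs_ge_self])
qed

text \<open>Telescoping: the difference of the k-th powers is a sum of k terms, each with one factor
  \<open>g - f\<close>, powers of \<open>g\<close> to its left and of \<open>f\<close> to its right.
  In the induction the trajectory from \<open>f x\<close> meets the hypothesis with
  \<open>M * lam\<close>, hence the generalization over \<open>x\<close> and
  \<open>M\<close>.\<close>

lemma funpow_diff_le:
  fixes f g :: "'a::real_normed_vector \<Rightarrow> 'a"
  assumes g: "linear g" "\<And>k x. norm ((g ^^ k) x) \<le> \<gamma> * lam ^ k * norm x"
    and fg: "\<And>x. norm (g x - f x) \<le> D * norm x"
    and "0 < lam" "0 \<le> D" "0 \<le> \<gamma>"
    and f: "\<And>j. norm ((f ^^ j) x) \<le> M * lam ^ j"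
  shows "norm ((g ^^ k) x - (f ^^ k) x) \<le> real k * \<gamma> * D * M * lam ^ k / lam"
  using f
proof (induction k arbitrary: x M)
  case 0
  then show ?case by simp
next
  case (Suc k)
  have lin: "linear (g ^^ k)" using g(1) by (induction k) (auto intro: linear_compose linear_id)
  have "(g ^^ Suc k) x - (f ^^ Suc k) x = (g ^^ k) (g x - f x) + ((g ^^ k) (f x) - (f ^^ k) (f x))"
    by (simp add: funpow_swap1 linear_diff[OF lin])
  then have "norm ((g ^^ Suc k) x - (f ^^ Suc k) x)
      \<le> norm ((g ^^ k) (g x - f x)) + norm ((g ^^ k) (f x) - (f ^^ k) (f x))"
    by (simp add: norm_triangle_ineq)
  also have "norm ((g ^^ k) (g x - f x)) \<le> \<gamma> * lam ^ k * (D * M)"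
  proof -
    have "norm (g x - f x) \<le> D * M"
      using fg[of x] Suc.prems[of 0] assms(5) by (auto intro: order_trans mult_left_mono)
    then show ?thesis using assms(4,6) by (intro order_trans[OF g(2)] mult_left_mono) auto
  qed
  also have "norm ((g ^^ k) (f x) - (f ^^ k) (f x)) \<le> real k * \<gamma> * D * (M * lam) * lam ^ k / lam"
    by (rule Suc.IH) (use Suc.prems[of "Suc _"] in \<open>simp add: funpow_swap1 mult_ac\<close>)
  also have "\<gamma> * lam ^ k * (D * M) + real k * \<gamma> * D * (M * lam) * lam ^ k / lam
      = real (Suc k) * \<gamma> * D * M * lam ^ Suc k / lam"
    using assms(4) by (simp add: field_simps)
  finally show ?case by simp
qed

text \<open>\<open>N\<close> is the supremum of the powers weighted by inverse powers of \<mu>.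
  Shifting the index under the supremum costs the factor \<mu>, which gives the contraction. The
  strict gap \<open>lam < \<mu>\<close> serves the dependence on \<theta>: it absorbs the factor k
  from \<open>funpow_diff_le\<close>.\<close>

lemma adapted_norm:
  fixes F :: "'p::real_normed_vector \<Rightarrow> 'a::real_normed_vector \<Rightarrow> 'a"
  assumes lin: "\<And>\<theta>. \<theta> \<in> S \<Longrightarrow> linear (F \<theta>)"
    and pow: "\<And>\<theta> k x. \<theta> \<in> S \<Longrightarrow> norm ((F \<theta> ^^ k) x) \<le> \<gamma> * lam ^ k * norm x"
    and lip: "\<And>\<theta> \<theta>' x. \<theta> \<in> S \<Longrightarrow> \<theta>' \<in> S \<Longrightarrow> norm (F \<theta> x - F \<theta>' x) \<le> L * norm (\<theta> - \<theta>') * norm x"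
    and "0 < lam" "lam < \<mu>" "0 \<le> \<gamma>" "0 \<le> L"
  shows "\<exists>N C. 0 \<le> C \<and> (\<forall>\<theta>\<in>S. \<forall>x. norm x \<le> N \<theta> x \<and> N \<theta> x \<le> \<gamma> * norm x \<and> N \<theta> (F \<theta> x) \<le> \<mu> * N \<theta> x) \<and>
    (\<forall>\<theta>\<in>S. \<forall>x y. N \<theta> (x + y) \<le> N \<theta> x + N \<theta> y) \<and>
    (\<forall>\<theta>\<in>S. \<forall>\<theta>'\<in>S. \<forall>x. N \<theta>' x \<le> (1 + C * norm (\<theta>' - \<theta>)) * N \<theta> x)"
proof -
  have \<mu>: "0 < \<mu>" using assms by linarith
  define N where "N = (\<lambda>\<theta> x. SUP k. norm ((F \<theta> ^^ k) x) / \<mu> ^ k)"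
  obtain C where C: "0 \<le> C" "\<And>k. real k * (lam / \<mu>) ^ k \<le> C"
    using power_times_n_bounded[of "lam / \<mu>"] assms \<mu> by auto
  have term_le: "norm ((F \<theta> ^^ k) x) / \<mu> ^ k \<le> \<gamma> * norm x" if "\<theta> \<in> S" for \<theta> k x
  proof -
    have "norm ((F \<theta> ^^ k) x) \<le> \<gamma> * lam ^ k * norm x" by (rule pow[OF that])
    also have "\<dots> \<le> \<gamma> * \<mu> ^ k * norm x"
      using assms(4-7) by (intro mult_right_mono mult_left_mono power_mono) auto
    finally show ?thesis using \<mu> by (simp add: field_simps)
  qed
  have bdd: "bdd_above (range (\<lambda>k. norm ((F \<theta> ^^ k) x) / \<mu> ^ k))" if "\<theta> \<in> S" for \<theta> x
    using term_le[OF that] by (intro bdd_aboveI2)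
  have upper: "norm ((F \<theta> ^^ k) x) / \<mu> ^ k \<le> N \<theta> x" if "\<theta> \<in> S" for \<theta> k x
    unfolding N_def by (rule cSUP_upper[OF UNIV_I bdd[OF that]])
  have lower: "norm x \<le> N \<theta> x" if "\<theta> \<in> S" for \<theta> x
    using upper[OF that, of 0 x] by simp
  have N\<gamma>: "N \<theta> x \<le> \<gamma> * norm x" if "\<theta> \<in> S" for \<theta> x
    unfolding N_def using term_le[OF that] by (intro cSUP_least) auto
  have NF: "N \<theta> (F \<theta> x) \<le> \<mu> * N \<theta> x" if "\<theta> \<in> S" for \<theta> x
    unfolding N_def
  proof (rule cSUP_least, simp)
    fix k
    have "norm ((F \<theta> ^^ k) (F \<theta> x)) / \<mu> ^ k = \<mu> * (norm ((F \<theta> ^^ Suc k) x) / \<mu> ^ Suc k)"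
      using \<mu> by (simp add: funpow_swap1)
    also have "\<dots> \<le> \<mu> * N \<theta> x" using upper[OF that, of "Suc k" x] \<mu> by (intro mult_left_mono) auto
    finally show "norm ((F \<theta> ^^ k) (F \<theta> x)) / \<mu> ^ k \<le> \<mu> * (SUP k. norm ((F \<theta> ^^ k) x) / \<mu> ^ k)"
      by (simp add: N_def)
  qed
  have Nadd: "N \<theta> (x + y) \<le> N \<theta> x + N \<theta> y" if "\<theta> \<in> S" for \<theta> x y
  proof -
    have "norm ((F \<theta> ^^ k) (x + y)) / \<mu> ^ k \<le> N \<theta> x + N \<theta> y" for k
    proof -
      have lin: "linear (F \<theta> ^^ k)" 
        using lin[OF that] by (induction k) (auto intro: linear_compose linear_id)
      have "norm ((F \<theta> ^^ k) (x + y)) / \<mu> ^ k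
          \<le> (norm ((F \<theta> ^^ k) x) + norm ((F \<theta> ^^ k) y)) / \<mu> ^ k"
        using \<mu> by (simp add: linear_add[OF lin] norm_triangle_ineq divide_right_mono)
      also have "\<dots> \<le> N \<theta> x + N \<theta> y"
        using upper[OF that, of k x] upper[OF that, of k y] by (simp add: add_divide_distrib)
      finally show ?thesis .
    qed
    then show ?thesis unfolding N_def by (intro cSUP_least) auto
  qed
  define C' where "C' = C * \<gamma> * L * \<gamma> / lam"
  have C'0: "0 \<le> C'" using C assms by (simp add: C'_def)
  have Nlip: "N \<theta>' x \<le> (1 + C' * norm (\<theta>' - \<theta>)) * N \<theta> x" if t: "\<theta> \<in> S" "\<theta>' \<in> S" for \<theta> \<theta>' x
    unfolding N_def
  proof (rule cSUP_least, simp)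
    fix k
    let ?D = "L * norm (\<theta>' - \<theta>)"
    have D: "norm ((F \<theta>' ^^ k) x - (F \<theta> ^^ k) x) \<le> real k * \<gamma> * ?D * (\<gamma> * norm x) * lam ^ k / lam"
      by (rule funpow_diff_le[where g = "F \<theta>'" and f = "F \<theta>"])
         (use pow[OF t(1)] pow[OF t(2)] lin[OF t(2)] lip[OF t(2,1)] assms(4-7) in \<open>auto simp: mult_ac\<close>)
    have "norm ((F \<theta>' ^^ k) x) \<le> norm ((F \<theta> ^^ k) x) + norm ((F \<theta>' ^^ k) x - (F \<theta> ^^ k) x)"
      by (metis add.commute diff_add_cancel norm_triangle_ineq)
    then have "norm ((F \<theta>' ^^ k) x) / \<mu> ^ k
       \<le> norm ((F \<theta> ^^ k) x) / \<mu> ^ k + norm ((F \<theta>' ^^ k) x - (F \<theta> ^^ k) x) / \<mu> ^ k"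
      using \<mu> by (simp add: add_divide_distrib[symmetric] divide_right_mono)
    also have "norm ((F \<theta>' ^^ k) x - (F \<theta> ^^ k) x) / \<mu> ^ k
       \<le> (real k * \<gamma> * ?D * (\<gamma> * norm x) * lam ^ k / lam) / \<mu> ^ k"
      using D \<mu> by (intro divide_right_mono) auto
    also have "\<dots> = (real k * (lam / \<mu>) ^ k) * (\<gamma> * ?D * (\<gamma> * norm x) / lam)"
      by (simp add: power_divide mult_ac)
    also have "\<dots> \<le> C * (\<gamma> * ?D * (\<gamma> * norm x) / lam)"
      using C(2)[of k] assms(4-7) by (intro mult_right_mono) auto
    also have "\<dots> = C' * norm (\<theta>' - \<theta>) * norm x" by (simp add: C'_def)
    also have "\<dots> \<le> C' * norm (\<theta>' - \<theta>) * N \<theta> x"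
      using lower[OF t(1)] C'0 by (intro mult_left_mono) auto
    finally show "norm ((F \<theta>' ^^ k) x) / \<mu> ^ k
        \<le> (1 + C' * norm (\<theta>' - \<theta>)) * (SUP k. norm ((F \<theta> ^^ k) x) / \<mu> ^ k)"
      using upper[OF t(1), of k x] by (simp add: N_def algebra_simps)
  qed
  show ?thesis
    by (intro exI[of _ N] exI[of _ C']) (use C'0 lower N\<gamma> NF Nadd Nlip in blast)
qed

text \<open>Discrete variation of constants; the forcing at \<open>j\<close> is multiplied only by
  the factors after \<open>j\<close>.\<close>

lemma linear_recursion_bound:
  fixes w a h :: "nat \<Rightarrow> real"
  assumes "\<And>t. t < n \<Longrightarrow> 0 \<le> a t" and "\<And>t. t < n \<Longrightarrow> w (Suc t) \<le> a t * w t + h t"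
  shows "w n \<le> (\<Prod>i<n. a i) * w 0 + (\<Sum>j<n. (\<Prod>i\<in>{Suc j..<n}. a i) * h j)"
  using assms
proof (induction n)
  case 0
  then show ?case by simp
next
  case (Suc n)
  have "w (Suc n) \<le> a n * w n + h n" using Suc.prems by simp
  also have "\<dots> \<le> a n * ((\<Prod>i<n. a i) * w 0 + (\<Sum>j<n. (\<Prod>i\<in>{Suc j..<n}. a i) * h j)) + h n"
    using Suc.IH Suc.prems by (simp add: mult_left_mono)
  also have "a n * (\<Sum>j<n. (\<Prod>i\<in>{Suc j..<n}. a i) * h j) = (\<Sum>j<n. (\<Prod>i\<in>{Suc j..<Suc n}. a i) * h j)"
    by (auto simp: sum_distrib_left mult_ac intro!: sum.cong)
  ultimately show ?case by (simp add: algebra_simps)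
qed

text \<open>Single factors \<open>exp (g t)\<close> may be large; only the sums of \<open>g\<close>
  over final segments matter. Their linear part raises the rate from \<mu> to \<open>lam\<close>,
  their constant part becomes the overshoot \<open>exp D\<close>.\<close>

lemma slowly_varying_recursion:
  fixes w g h :: "nat \<Rightarrow> real"
  assumes "0 < \<mu>" and step: "\<And>t. t < n \<Longrightarrow> w (Suc t) \<le> \<mu> * exp (g t) * w t + h t"
    and avg: "\<And>j. j \<le> n \<Longrightarrow> sum g {j..<n} \<le> D + \<kappa> * real (n - j)"
    and "\<mu> * exp \<kappa> = lam" "0 \<le> w 0" "\<And>t. t < n \<Longrightarrow> 0 \<le> h t"
  shows "w n \<le> exp D * lam ^ n * w 0 + (\<Sum>j<n. exp D * lam ^ (n - 1 - j) * h j)"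
proof -
  have prod_le: "(\<Prod>i\<in>{j..<n}. \<mu> * exp (g i)) \<le> exp D * lam ^ (n - j)" if "j \<le> n" for j
  proof -
    have "(\<Prod>i\<in>{j..<n}. \<mu> * exp (g i)) = \<mu> ^ (n - j) * exp (sum g {j..<n})"
      by (simp add: prod.distrib exp_sum)
    also have "\<dots> \<le> \<mu> ^ (n - j) * exp (D + \<kappa> * real (n - j))"
      using avg[OF that] assms(1) by simp
    also have "\<dots> = exp D * lam ^ (n - j)"
      unfolding assms(4)[symmetric]
      by (simp add: exp_add power_mult_distrib exp_of_nat_mult[symmetric] mult_ac)
    finally show ?thesis .
  qed
  have "w n \<le> (\<Prod>i<n. \<mu> * exp (g i)) * w 0 + (\<Sum>j<n. (\<Prod>i\<in>{Suc j..<n}. \<mu> * exp (g i)) * h j)"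
    by (rule linear_recursion_bound) (use assms in auto)
  also have "\<dots> \<le> exp D * lam ^ n * w 0 + (\<Sum>j<n. exp D * lam ^ (n - 1 - j) * h j)"
  proof (intro add_mono sum_mono mult_right_mono)
    show "(\<Prod>i<n. \<mu> * exp (g i)) \<le> exp D * lam ^ n"
      using prod_le[of 0] by (simp add: atLeast0LessThan)
    show "(\<Prod>i\<in>{Suc j..<n}. \<mu> * exp (g i)) \<le> exp D * lam ^ (n - 1 - j)" if "j \<in> {..<n}" for j
      using prod_le[of "Suc j"] that by simp
  qed (use assms in auto)
  finally show ?thesis .
qed

section \<open>The adaptive loop\<close>

text \<open>Projection onto \<open>S\<close> is nonexpansive and fixes both \<theta> and
  \<open>\<theta>s\<close>, so it suffices to study the unprojected update. Expanding its squared
  distance to \<open>\<theta>s\<close> gives the Lyapunov inequality of the projection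
  algorithm.\<close>

lemma projection_step:
  fixes \<theta> \<theta>s \<phi> :: "'a::euclidean_space"
  assumes S: "convex S" "closed S" "\<theta> \<in> S" "\<theta>s \<in> S" and "\<phi> \<noteq> 0"
    and e: "e = \<phi> \<bullet> \<theta>s + d - \<phi> \<bullet> \<theta>"
  defines "\<theta>' \<equiv> closest_point S (\<theta> + (e / (\<phi> \<bullet> \<phi>)) *\<^sub>R \<phi>)"
  shows "norm (\<theta>' - \<theta>) \<le> \<bar>e\<bar> / norm \<phi>"
    and "(\<bar>e\<bar> / norm \<phi>)\<^sup>2 / 2 \<le> (norm (\<theta> - \<theta>s))\<^sup>2 - (norm (\<theta>' - \<theta>s))\<^sup>2 + 2 * (\<bar>d\<bar> / norm \<phi>)\<^sup>2"
proof -
  define c where "c = e / (\<phi> \<bullet> \<phi>)"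
  have ne: "S \<noteq> {}" using S by auto
  have proj: "norm (\<theta>' - z) \<le> norm (\<theta> + c *\<^sub>R \<phi> - z)" if "z \<in> S" for z
    using closest_point_lipschitz[OF S(1,2) ne, of "\<theta> + c *\<^sub>R \<phi>" z] closest_point_self[OF that]
    by (simp add: \<theta>'_def c_def dist_norm)
  have \<phi>\<phi>: "\<phi> \<bullet> \<phi> = (norm \<phi>)\<^sup>2" by (simp add: power2_norm_eq_inner)
  have n0: "0 < norm \<phi>" using assms(5) by simp
  have "norm (\<theta>' - \<theta>) \<le> norm (c *\<^sub>R \<phi>)" using proj[OF S(3)] by simp
  also have "\<dots> = \<bar>e\<bar> / norm \<phi>"
    using n0 by (simp add: c_def \<phi>\<phi> power2_eq_square)
  finally show "norm (\<theta>' - \<theta>) \<le> \<bar>e\<bar> / norm \<phi>" .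
  have w: "\<phi> \<bullet> (\<theta> - \<theta>s) = d - e" using e by (simp add: inner_diff_right)
  have "(norm (\<theta>' - \<theta>s))\<^sup>2 \<le> (norm (\<theta> - \<theta>s + c *\<^sub>R \<phi>))\<^sup>2"
    using proj[OF S(4)] by (intro power_mono) (simp_all add: algebra_simps)
  also have "\<dots> = (norm (\<theta> - \<theta>s))\<^sup>2 + (2 * c * (d - e) + c\<^sup>2 * (norm \<phi>)\<^sup>2)"
    unfolding w[symmetric] power2_norm_eq_inner
    by (simp add: inner_add_left inner_add_right inner_commute power2_eq_square)
  also have "2 * c * (d - e) + c\<^sup>2 * (norm \<phi>)\<^sup>2 = (2 * e * d - e\<^sup>2) / (norm \<phi>)\<^sup>2"
    using n0 by (simp add: c_def \<phi>\<phi> power2_eq_square field_simps)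
  finally have 1: "(norm (\<theta>' - \<theta>s))\<^sup>2 \<le> (norm (\<theta> - \<theta>s))\<^sup>2 + (2 * e * d - e\<^sup>2) / (norm \<phi>)\<^sup>2" .
  \<comment> \<open>Young's inequality for the cross term \<open>2 * e * d\<close>, keeping half of
    the gain from \<open>e\<close> squared.\<close>
  have "0 \<le> (e - 2 * d)\<^sup>2" by simp
  then have "2 * e * d - e\<^sup>2 \<le> 2 * d\<^sup>2 - e\<^sup>2 / 2" by (simp add: power2_eq_square algebra_simps)
  then have "(2 * e * d - e\<^sup>2) / (norm \<phi>)\<^sup>2 \<le> (2 * d\<^sup>2 - e\<^sup>2 / 2) / (norm \<phi>)\<^sup>2"
    by (intro divide_right_mono) auto
  with 1 show "(\<bar>e\<bar> / norm \<phi>)\<^sup>2 / 2 \<le> (norm (\<theta> - \<theta>s))\<^sup>2 - (norm (\<theta>' - \<theta>s))\<^sup>2 + 2 * (\<bar>d\<bar> / norm \<phi>)\<^sup>2"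
    by (simp add: power_divide diff_divide_distrib)
qed

text \<open>By \<open>1 + x \<le> exp x\<close> both effects of \<nu>, the change of norm and the
  perturbation of the loop, go into one exponent on the state; on the input \<open>r\<close> the
  bound \<open>B\<close> is enough.\<close>

lemma perturbed_contraction_step:
  fixes C :: real
  assumes "0 \<le> C" "0 < \<mu>" "0 \<le> \<gamma>" "0 \<le> \<nu>" "\<nu> \<le> B" "0 \<le> w" "0 \<le> r"
    and x: "x \<le> (1 + C * \<nu>) * (\<mu> * w + \<gamma> * (\<nu> * w) + \<gamma> * r)"
  shows "x \<le> \<mu> * exp ((C + \<gamma> / \<mu>) * \<nu>) * w + (1 + C * B) * \<gamma> * r"
proof -
  have "(1 + C * \<nu>) * (1 + \<gamma> / \<mu> * \<nu>) \<le> exp (C * \<nu>) * exp (\<gamma> / \<mu> * \<nu>)"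
    using assms(1-4) by (intro mult_mono exp_ge_add_one_self) auto
  also have "\<dots> = exp ((C + \<gamma> / \<mu>) * \<nu>)" by (simp add: exp_add[symmetric] distrib_right)
  finally have "(1 + C * \<nu>) * (1 + \<gamma> / \<mu> * \<nu>) * (\<mu> * w) \<le> exp ((C + \<gamma> / \<mu>) * \<nu>) * (\<mu> * w)"
    using assms(2,6) by (intro mult_right_mono) auto
  moreover have "(1 + C * \<nu>) * (\<gamma> * r) \<le> (1 + C * B) * (\<gamma> * r)"
    using assms by (intro mult_right_mono add_left_mono mult_left_mono) auto
  moreover have "(1 + C * \<nu>) * (\<mu> * w + \<gamma> * (\<nu> * w) + \<gamma> * r)
      = (1 + C * \<nu>) * (1 + \<gamma> / \<mu> * \<nu>) * (\<mu> * w) + (1 + C * \<nu>) * (\<gamma> * r)"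
    using assms(2) by (simp add: field_simps)
  ultimately show ?thesis using x by (simp add: mult_ac)
qed

lemma sum_int_shift:
  "(\<Sum>t = m + int j..m + int n - 1. f t) = (\<Sum>i = j..<n. f (m + int i))"
  by (rule sum.reindex_bij_witness[of _ "\<lambda>i. m + int i" "\<lambda>t. nat (t - m)"]) auto

text \<open>Factorization of a difference of squares; it prices a move of the true parameter in the
  squared estimation error.\<close>

lemma norm_diff_square_le:
  fixes a b b' :: "'a::real_normed_vector"
  assumes "norm a \<le> R" "norm b \<le> R" "norm b' \<le> R"
  shows "(norm (a - b'))\<^sup>2 \<le> (norm (a - b))\<^sup>2 + 4 * R * norm (b' - b)"
proof -
  have "norm (a - b') \<le> norm (a - b) + norm (b' - b)"
    using norm_triangle_ineq4[of "a - b" "b' - b"] by simp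
  moreover have "norm (a - b') \<le> 2 * R" "norm (a - b) \<le> 2 * R"
    using norm_triangle_ineq4[of a b'] norm_triangle_ineq4[of a b] assms by linarith+
  ultimately have "(norm (a - b') - norm (a - b)) * (norm (a - b') + norm (a - b)) \<le> norm (b' - b) * (4 * R)"
    by (intro mult_mono) auto
  then show ?thesis by (simp add: power2_eq_square algebra_simps)
qed

theorem theorem2:
  fixes pos :: "'n::finite \<Rightarrow> nat"
    and S :: "'n param set"
    and Astar :: "real poly"
    and \<delta> :: ereal
    and lam1 c0 :: real
  assumes "numbering pos"
    and "parameter_set pos S"
    and "target_poly (2 * CARD('n)) Astar"
    and "0 < \<delta>"
    and "root_radius (2 * CARD('n)) Astar < lam1" and "lam1 < 1"
    and "0 \<le> c0"
  shows "\<exists>c1>0. \<exists>\<epsilon>>0.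
    \<forall>t0. \<forall>\<theta>0\<in>S. \<forall>\<theta>star\<in>admissible S c0 \<epsilon>. \<forall>\<phi>0 ystar d y u \<theta>hat.
      bounded (range ystar) \<longrightarrow> bounded (range d) \<longrightarrow>
      closed_loop pos S Astar \<delta> t0 \<theta>0 \<theta>star \<phi>0 ystar d y u \<theta>hat \<longrightarrow>
      (\<forall>k\<ge>t0. norm (regressor pos y u k)
         \<le> c1 * lam1 ^ nat (k - t0) * norm \<phi>0
           + (\<Sum>j=t0..k-1. c1 * lam1 ^ nat (k - 1 - j)
                * (\<bar>filtered_ref pos Astar \<theta>hat ystar j\<bar> + \<bar>d j\<bar>)))"
proof -

  \<comment> \<open>Uniform bounds on the parameter set and the adapted norm\<close>
  have ne: "S \<noteq> {}" and conv: "convex S" and comp: "compact S"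
    using assms(2) by (auto simp: parameter_set_def)
  have clos: "closed S" using comp by (rule compact_imp_closed)
  define R where "R = set_norm S"
  have R: "norm \<theta> \<le> R" if "\<theta> \<in> S" for \<theta>
  proof -
    have "bdd_above (norm ` S)"
      using compact_imp_bounded[OF comp] by (simp add: bdd_above_norm)
    then show ?thesis using that unfolding R_def set_norm_def by (rule cSUP_upper[rotated])
  qed
  have R0: "0 \<le> R" using R ne norm_ge_zero order_trans by blast
  have rr: "0 \<le> root_radius (2 * CARD('n)) Astar" by (rule root_radius_properties(1)[OF assms(1,3)])
  \<comment> \<open>The gap below \<open>lam1\<close> is split: from \<open>lam\<close> to \<mu> for
    the Lipschitz property of the adapted norm, from \<mu> to \<open>lam1\<close> for the losses due
    to adaptation.\<close>
  obtain lam where lam: "root_radius (2 * CARD('n)) Astar < lam" "lam < lam1"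
    using dense[OF assms(5)] by blast
  obtain \<mu> where \<mu>: "lam < \<mu>" "\<mu> < lam1" using dense[OF lam(2)] by blast
  have pos: "0 < lam" "0 < \<mu>" "0 < lam1" "lam < 1" using rr lam \<mu> assms(6) by linarith+
  let ?F = "frozen_loop pos Astar"
  obtain \<gamma> L where \<gamma>L: "0 \<le> \<gamma>" "0 \<le> L"
    and pow: "\<And>\<theta> k x. \<theta> \<in> S \<Longrightarrow> norm ((?F \<theta> ^^ k) x) \<le> \<gamma> * lam ^ k * norm x"
    and lip: "\<And>\<theta> \<theta>' x. \<theta> \<in> S \<Longrightarrow> \<theta>' \<in> S \<Longrightarrow> norm (?F \<theta> x - ?F \<theta>' x) \<le> L * norm (\<theta> - \<theta>') * norm x"
    using frozen_loop_uniform[OF assms(1-3) lam(1) pos(4)] by blast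
  have lin: "\<And>\<theta>. linear (?F \<theta>)" by (rule linear_frozen_loop[OF assms(1)])
  have F_le: "norm (?F \<theta> x) \<le> \<gamma> * norm x" if "\<theta> \<in> S" for \<theta> x
  proof -
    have "norm (?F \<theta> x) \<le> \<gamma> * lam * norm x" using pow[OF that, of 1 x] by simp
    also have "\<dots> \<le> \<gamma> * norm x"
      using \<gamma>L pos by (intro mult_right_mono) (auto intro: mult_left_le)
    finally show ?thesis .
  qed
  obtain N C where C: "0 \<le> C"
    and N: "\<And>\<theta> x. \<theta> \<in> S \<Longrightarrow> norm x \<le> N \<theta> x" "\<And>\<theta> x. \<theta> \<in> S \<Longrightarrow> N \<theta> x \<le> \<gamma> * norm x"
      "\<And>\<theta> x. \<theta> \<in> S \<Longrightarrow> N \<theta> (?F \<theta> x) \<le> \<mu> * N \<theta> x"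
    and Nadd: "\<And>\<theta> x y. \<theta> \<in> S \<Longrightarrow> N \<theta> (x + y) \<le> N \<theta> x + N \<theta> y"
    and Nlip: "\<And>\<theta> \<theta>' x. \<theta> \<in> S \<Longrightarrow> \<theta>' \<in> S \<Longrightarrow> N \<theta>' x \<le> (1 + C * norm (\<theta>' - \<theta>)) * N \<theta> x"
    using adapted_norm[of S ?F \<gamma> lam L \<mu>, OF lin pow lip pos(1) \<mu>(1) \<gamma>L] by blast

  \<comment> \<open>Choice of the constants\<close>
  define \<kappa> where "\<kappa> = ln (lam1 / \<mu>)"
  have \<kappa>: "0 < \<kappa>" "\<mu> * exp \<kappa> = lam1" using \<mu> pos by (auto simp: \<kappa>_def)
  define K where "K = C + \<gamma> / \<mu> + 1"
  have K: "1 \<le> K" "C + \<gamma> / \<mu> \<le> K" using C \<gamma>L pos by (auto simp: K_def)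
  \<comment> \<open>The tolerated mean of the squared \<nu>, chosen so that in Young's inequality
    below both summands contribute \<open>\<kappa> / 2\<close> per step.\<close>
  define \<eta> where "\<eta> = \<kappa>\<^sup>2 / K\<^sup>2"
  have \<eta>: "0 < \<eta>" "K\<^sup>2 / (2 * \<kappa>) * \<eta> = \<kappa> / 2"
    using \<kappa> K by (auto simp: \<eta>_def power2_eq_square)
  \<comment> \<open>Parameter drift may use half of \<eta>. The summand 1 keeps the denominator
    positive when \<open>R = 0\<close>.\<close>
  define \<epsilon> where "\<epsilon> = \<eta> / (16 * R + 1)"
  have "16 * R * \<eta> \<le> \<eta> * (16 * R + 1)" using \<eta>(1) by (simp add: algebra_simps)
  then have \<epsilon>: "0 < \<epsilon>" "8 * R * \<epsilon> \<le> \<eta> / 2" using \<eta> R0 by (auto simp: \<epsilon>_def field_simps)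
  \<comment> \<open>A finite substitute, since \<delta> may be infinite.\<close>
  obtain \<delta>' where \<delta>': "0 < \<delta>'" "ereal \<delta>' \<le> \<delta>"
  proof (cases \<delta>)
    case (real r)
    then show ?thesis using that[of r] assms(4) by auto
  next
    case PInf
    then show ?thesis using that[of 1] by auto
  qed (use assms(4) in auto)
  \<comment> \<open>Below \<open>\<delta>'\<close> the estimator is active at good times; below 1
    the ratio \<nu> is at most \<open>2 * R + 1\<close>; with \<open>\<eta> / 8\<close> the
    disturbance uses the other half of \<eta>.\<close>
  define \<upsilon> where "\<upsilon> = min 1 (min (\<eta> / 8) \<delta>')"
  have \<upsilon>: "0 < \<upsilon>" "\<upsilon> \<le> 1" "\<upsilon> \<le> \<delta>'" "\<upsilon> \<le> \<eta> / 8" using \<eta> \<delta>' by (auto simp: \<upsilon>_def)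
  have \<upsilon>2: "4 * \<upsilon>\<^sup>2 \<le> \<eta> / 2"
  proof -
    have "\<upsilon> * \<upsilon> \<le> \<upsilon> * 1" using \<upsilon> by (intro mult_left_mono) auto
    then show ?thesis using \<upsilon>(4) by (simp add: power2_eq_square)
  qed
  \<comment> \<open>The part of the sums that does not grow with length: the initial squared error
    gives \<open>8 * R\<^sup>2\<close>, the constant \<open>c0\<close> of the drift bound gives
    \<open>8 * R * c0\<close>.\<close>
  define D where "D = K\<^sup>2 / (2 * \<kappa>) * (8 * R\<^sup>2 + 8 * R * c0)"
  define G where "G = (1 + C * (2 * R + 1)) * \<gamma>"
  define cI where "cI = exp D * (\<gamma> + G)"
  \<comment> \<open>One step from a bad time: the state there is at most
    \<open>1 / \<upsilon>\<close> times the disturbance, and the final 1 covers the direct effect of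
    the disturbance or of \<open>r\<close>.\<close>
  define Kb where "Kb = (\<gamma> + 2 * R) / \<upsilon> + 1"
  define c1 where "c1 = cI * Kb + 1"
  have G0: "0 \<le> G" using C R0 \<gamma>L by (simp add: G_def)
  have cI0: "0 \<le> cI" using G0 \<gamma>L by (simp add: cI_def)
  have Kb1: "1 \<le> Kb" using \<gamma>L R0 \<upsilon> by (simp add: Kb_def)
  have c1: "0 < c1" "cI \<le> c1" "cI * Kb \<le> c1"
    using cI0 Kb1 mult_left_mono[OF Kb1 cI0] by (auto simp: c1_def intro: add_nonneg_pos)

  show ?thesis
  proof (rule exI[of _ c1], rule conjI[OF c1(1)], rule exI[of _ \<epsilon>], rule conjI[OF \<epsilon>(1)],
      intro allI ballI impI)
    fix t0 \<theta>0 \<theta>star \<phi>0 ystar d y u \<theta>hat and k :: int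
    assume \<theta>0: "\<theta>0 \<in> S" and adm: "\<theta>star \<in> admissible S c0 \<epsilon>"
      and cl: "closed_loop pos S Astar \<delta> t0 \<theta>0 \<theta>star \<phi>0 ystar d y u \<theta>hat"
      and k: "t0 \<le> k"

    \<comment> \<open>Signals and the perturbed loop equation\<close>
    define \<phi> where "\<phi> = regressor pos y u"
    define r where "r = filtered_ref pos Astar \<theta>hat ystar"
    define e where "e t = y (t + 1) - \<phi> t \<bullet> \<theta>hat t" for t
    define \<nu> where "\<nu> t = \<bar>e t\<bar> / norm (\<phi> t)" for t
    have init: "\<phi> t0 = \<phi>0" "\<theta>hat t0 = \<theta>0"
      and plant: "\<And>t. t0 \<le> t \<Longrightarrow> y (t + 1) = \<phi> t \<bullet> \<theta>star t + d t"
      and est: "\<And>t. t0 \<le> t \<Longrightarrow> \<theta>hat (t + 1) = estimator_step S \<delta> (\<phi> t) (y (t + 1)) (\<theta>hat t)"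
      using cl by (auto simp: closed_loop_def \<phi>_def)
    have star: "\<theta>star t \<in> S" for t using adm by (simp add: admissible_def)
    have drift: "(\<Sum>t = t1..t2 - 1. norm (\<theta>star (t + 1) - \<theta>star t)) \<le> c0 + \<epsilon> * real_of_int (t2 - t1)"
      if "t1 < t2" for t1 t2
      using adm that by (simp add: admissible_def)
    have hat: "\<theta>hat t \<in> S" if "t0 \<le> t" for t
      using that
    proof (induction t rule: int_ge_induct)
      case (step t)
      show ?case unfolding est[OF step.hyps(1)] estimator_step_def Let_def
        by (rule closest_point_in_set[OF clos ne])
    qed (simp add: init \<theta>0)
    \<comment> \<open>By the definition of \<open>e\<close>, the output is the one predicted by the
      estimate plus \<open>e\<close>; the true parameter enters only through
      \<open>e\<close>.\<close>
    have loop: "\<phi> (t + 1) = ?F (\<theta>hat t) (\<phi> t) + (e t *\<^sub>R unit_y pos + r t *\<^sub>R unit_u pos)"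
      if t: "t0 \<le> t" for t
    proof -
      have "u (t + 1) = - (\<Sum>i\<in>UNIV. gainL pos Astar (\<theta>hat t) $ i * u (t + 1 - int (pos i)))
        - (\<Sum>i\<in>UNIV. gainP pos Astar (\<theta>hat t) $ i *
             (y (t + 1 - int (pos i)) - ystar (t + 1 - int (pos i))))"
        using cl t unfolding closed_loop_def by (auto dest: spec[of _ "t + 1"])
      also have "\<dots> = - (\<phi> t \<bullet> prod.swap (pole_placement pos Astar (\<theta>hat t))) + r t"
        by (simp add: \<phi>_def r_def filtered_ref_def regressor_def inner_prod_def inner_vec_def
            gainL_def gainP_def right_diff_distrib sum_subtractf algebra_simps)
      finally have u: "u (t + 1) = - (\<phi> t \<bullet> prod.swap (pole_placement pos Astar (\<theta>hat t))) + r t" .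
      have y: "y (t + 1) = \<phi> t \<bullet> \<theta>hat t + e t" by (simp add: e_def)
      have "\<phi> (t + 1) = shift_regressor pos (\<phi> t) + y (t + 1) *\<^sub>R unit_y pos + u (t + 1) *\<^sub>R unit_u pos"
        unfolding \<phi>_def by (rule regressor_Suc[OF assms(1)])
      then show ?thesis
        unfolding y u frozen_loop_def[OF assms(1)] by (simp add: scaleR_add_left scaleR_diff_left)
    qed
    have e_le: "\<bar>e t\<bar> \<le> 2 * R * norm (\<phi> t) + \<bar>d t\<bar>" if t: "t0 \<le> t" for t
    proof -
      have "e t = \<phi> t \<bullet> (\<theta>star t - \<theta>hat t) + d t"
        by (simp add: e_def plant[OF t] inner_diff_right)
      moreover have "\<bar>\<phi> t \<bullet> (\<theta>star t - \<theta>hat t)\<bar> \<le> norm (\<phi> t) * norm (\<theta>star t - \<theta>hat t)"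
        by (rule Cauchy_Schwarz_ineq2)
      moreover have "norm (\<theta>star t - \<theta>hat t) \<le> 2 * R"
        using norm_triangle_ineq4[of "\<theta>star t" "\<theta>hat t"] R[OF star[of t]] R[OF hat[OF t]] by linarith
      then have "norm (\<phi> t) * norm (\<theta>star t - \<theta>hat t) \<le> norm (\<phi> t) * (2 * R)"
        by (intro mult_left_mono) auto
      ultimately show ?thesis by (simp add: mult_ac)
    qed

    \<comment> \<open>The estimator at good times\<close>
    define good where "good t \<longleftrightarrow> \<bar>d t\<bar> < \<upsilon> * norm (\<phi> t)" for t
    \<comment> \<open>The strict inequality in \<open>good\<close> excludes a zero state, so the
      divisions below are legitimate.\<close>
    have good_nz: "\<phi> t \<noteq> 0" if "good t" for t using that by (auto simp: good_def)
    have good_est: "\<theta>hat (t + 1) = closest_point S (\<theta>hat t + (e t / (\<phi> t \<bullet> \<phi> t)) *\<^sub>R \<phi> t)"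
      if t: "t0 \<le> t" and g: "good t" for t
    proof -
      have "\<bar>e t\<bar> < (2 * R + \<upsilon>) * norm (\<phi> t)"
        using e_le[OF t] g by (simp add: good_def algebra_simps)
      then have "ereal \<bar>e t\<bar> < ereal (2 * R + \<upsilon>) * ereal (norm (\<phi> t))" by simp
      also have "\<dots> \<le> (ereal (2 * R) + \<delta>) * ereal (norm (\<phi> t))"
      proof (intro ereal_mult_right_mono)
        have "ereal \<upsilon> \<le> \<delta>" using \<upsilon>(3) \<delta>'(2) by (meson ereal_less_eq(3) order_trans)
        then show "ereal (2 * R + \<upsilon>) \<le> ereal (2 * R) + \<delta>"
          unfolding plus_ereal.simps(1)[symmetric] by (rule add_left_mono)
      qed simp
      finally have "rho S \<delta> (\<phi> t) (e t) = 1" by (simp add: rho_def R_def)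
      then show ?thesis
        unfolding est[OF t] estimator_step_def Let_def e_def by simp
    qed
    have good_\<nu>: "\<nu> t \<le> 2 * R + 1" if t: "t0 \<le> t" and g: "good t" for t
    proof -
      have "\<bar>e t\<bar> \<le> 2 * R * norm (\<phi> t) + \<upsilon> * norm (\<phi> t)"
        using e_le[OF t] g by (simp add: good_def)
      also have "\<dots> \<le> (2 * R + 1) * norm (\<phi> t)"
        using mult_right_mono[OF \<upsilon>(2) norm_ge_zero[of "\<phi> t"]] by (simp add: distrib_right)
      finally show ?thesis using good_nz[OF g] by (simp add: \<nu>_def divide_le_eq)
    qed
    have \<nu>0: "0 \<le> \<nu> t" for t by (simp add: \<nu>_def)
    have e_\<nu>: "\<bar>e t\<bar> = \<nu> t * norm (\<phi> t)" if "good t" for t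
      using good_nz[OF that] by (simp add: \<nu>_def)
    define V where "V t = (norm (\<theta>hat t - \<theta>star t))\<^sup>2" for t
    have V_le: "0 \<le> V t" "t0 \<le> t \<Longrightarrow> V t \<le> 4 * R\<^sup>2" for t
    proof -
      assume t: "t0 \<le> t"
      have "norm (\<theta>hat t - \<theta>star t) \<le> 2 * R"
        using norm_triangle_ineq4[of "\<theta>hat t" "\<theta>star t"] R[OF star[of t]] R[OF hat[OF t]] by linarith
      then show "V t \<le> 4 * R\<^sup>2"
        using power_mono[of _ "2 * R" 2] by (simp add: V_def power_mult_distrib)
    qed (simp add: V_def)
    \<comment> \<open>\<open>projection_step\<close> measures both estimates against
      \<open>\<theta>star t\<close>, but \<open>V (t + 1)\<close> uses
      \<open>\<theta>star (t + 1)\<close>; the exchange costs the drift term.\<close>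
    have good_step: "norm (\<theta>hat (t + 1) - \<theta>hat t) \<le> \<nu> t"
      "(\<nu> t)\<^sup>2 / 2 \<le> V t - V (t + 1) + 2 * \<upsilon>\<^sup>2 + 4 * R * norm (\<theta>star (t + 1) - \<theta>star t)"
      if t: "t0 \<le> t" and g: "good t" for t
    proof -
      have e: "e t = \<phi> t \<bullet> \<theta>star t + d t - \<phi> t \<bullet> \<theta>hat t" by (simp add: e_def plant[OF t])
      note ps = projection_step[OF conv clos hat[OF t] star[of t] good_nz[OF g] e, folded good_est[OF t g]]
      show "norm (\<theta>hat (t + 1) - \<theta>hat t) \<le> \<nu> t" using ps(1) by (simp add: \<nu>_def)
      have "\<bar>d t\<bar> / norm (\<phi> t) \<le> \<upsilon>" using g good_nz[OF g] by (simp add: good_def divide_le_eq)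
      then have "(\<bar>d t\<bar> / norm (\<phi> t))\<^sup>2 \<le> \<upsilon>\<^sup>2" by (intro power_mono) auto
      moreover have "V (t + 1) \<le> (norm (\<theta>hat (t + 1) - \<theta>star t))\<^sup>2 + 4 * R * norm (\<theta>star (t + 1) - \<theta>star t)"
        unfolding V_def using t by (intro norm_diff_square_le R hat star) auto
      ultimately show "(\<nu> t)\<^sup>2 / 2 \<le> V t - V (t + 1) + 2 * \<upsilon>\<^sup>2 + 4 * R * norm (\<theta>star (t + 1) - \<theta>star t)"
        using ps(2) by (simp add: \<nu>_def V_def)
    qed

    \<comment> \<open>Average size of the prediction error on good stretches\<close>
    have average: "(\<Sum>i = j..<n. K * \<nu> (m + int i)) \<le> D + \<kappa> * real (n - j)"
      if m: "t0 \<le> m" and g: "\<And>i. i < n \<Longrightarrow> good (m + int i)" and jn: "j \<le> n" for m n j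
    \<comment> \<open>The empty sum is separate because the drift bound is available only for
      \<open>t1 < t2\<close>.\<close>
    proof (cases "j = n")
      case True
      have "0 \<le> D" using \<kappa> R0 assms(7) by (simp add: D_def)
      with True show ?thesis by simp
    next
      case False
      then have "j < n" using jn by simp
      have "(\<Sum>i = j..<n. (\<nu> (m + int i))\<^sup>2)
        \<le> (\<Sum>i = j..<n. 2 * (V (m + int i) - V (m + int (Suc i))) + 4 * \<upsilon>\<^sup>2
              + 8 * R * norm (\<theta>star (m + int i + 1) - \<theta>star (m + int i)))"
      proof (rule sum_mono)
        fix i assume "i \<in> {j..<n}"
        with good_step(2)[of "m + int i"] g[of i] m
        show "(\<nu> (m + int i))\<^sup>2 \<le> 2 * (V (m + int i) - V (m + int (Suc i))) + 4 * \<upsilon>\<^sup>2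
              + 8 * R * norm (\<theta>star (m + int i + 1) - \<theta>star (m + int i))"
          by (simp add: algebra_simps)
      qed
      also have "\<dots> = 2 * (V (m + int j) - V (m + int n)) + 4 * \<upsilon>\<^sup>2 * real (n - j)
          + 8 * R * (\<Sum>i = j..<n. norm (\<theta>star (m + int i + 1) - \<theta>star (m + int i)))"
        using sum_Suc_diff'[OF jn, of "\<lambda>i. - 2 * V (m + int i)"]
        by (simp add: sum.distrib sum_distrib_left[symmetric])
      also have "\<dots> \<le> 8 * R\<^sup>2 + \<eta> / 2 * real (n - j) + 8 * R * (c0 + \<epsilon> * real (n - j))"
      proof (intro add_mono mult_left_mono mult_right_mono)
        show "2 * (V (m + int j) - V (m + int n)) \<le> 8 * R\<^sup>2"
          using V_le(2)[of "m + int j"] V_le(1)[of "m + int n"] m by simp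
        have "(\<Sum>t = m + int j..m + int n - 1. norm (\<theta>star (t + 1) - \<theta>star t))
            \<le> c0 + \<epsilon> * real_of_int ((m + int n) - (m + int j))"
          using \<open>j < n\<close> by (intro drift) simp
        then show "(\<Sum>i = j..<n. norm (\<theta>star (m + int i + 1) - \<theta>star (m + int i))) \<le> c0 + \<epsilon> * real (n - j)"
          using jn by (simp add: sum_int_shift of_nat_diff)
      qed (use \<upsilon>2 R0 in auto)
      also have "\<dots> = (8 * R\<^sup>2 + 8 * R * c0) + (\<eta> / 2 + 8 * R * \<epsilon>) * real (n - j)"
        by (simp add: algebra_simps)
      also have "\<dots> \<le> (8 * R\<^sup>2 + 8 * R * c0) + \<eta> * real (n - j)"
        using \<epsilon>(2) by (intro add_left_mono mult_right_mono) auto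
      finally have sq: "(\<Sum>i = j..<n. (\<nu> (m + int i))\<^sup>2) \<le> (8 * R\<^sup>2 + 8 * R * c0) + \<eta> * real (n - j)" .
      \<comment> \<open>Turns the bound on squares into one on first powers, at a cost of
        \<open>\<kappa> / 2\<close> per step.\<close>
      have young: "K * v \<le> K\<^sup>2 / (2 * \<kappa>) * v\<^sup>2 + \<kappa> / 2" for v
      proof -
        have "0 \<le> (K * v - \<kappa>)\<^sup>2" by simp
        then show ?thesis using \<kappa>(1) by (simp add: power2_eq_square field_simps)
      qed
      have "(\<Sum>i = j..<n. K * \<nu> (m + int i)) \<le> (\<Sum>i = j..<n. K\<^sup>2 / (2 * \<kappa>) * (\<nu> (m + int i))\<^sup>2 + \<kappa> / 2)"
        by (intro sum_mono young)
      also have "\<dots> = K\<^sup>2 / (2 * \<kappa>) * (\<Sum>i = j..<n. (\<nu> (m + int i))\<^sup>2) + \<kappa> / 2 * real (n - j)"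
        by (simp add: sum.distrib sum_distrib_left)
      also have "\<dots> \<le> K\<^sup>2 / (2 * \<kappa>) * ((8 * R\<^sup>2 + 8 * R * c0) + \<eta> * real (n - j)) + \<kappa> / 2 * real (n - j)"
        using sq \<kappa>(1) by (intro add_right_mono mult_left_mono) auto
      also have "\<dots> = D + (K\<^sup>2 / (2 * \<kappa>) * \<eta>) * real (n - j) + \<kappa> / 2 * real (n - j)"
        by (simp only: D_def distrib_left mult.assoc)
      also have "\<dots> = D + \<kappa> * real (n - j)" unfolding \<eta>(2) by simp
      finally show ?thesis .
    qed

    \<comment> \<open>Decay over a stretch of good times\<close>
    have interval: "norm (\<phi> (m + int n)) \<le> cI * lam1 ^ n * norm (\<phi> m)
        + (\<Sum>j<n. cI * lam1 ^ (n - 1 - j) * \<bar>r (m + int j)\<bar>)"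
      if m: "t0 \<le> m" and g: "\<And>i. i < n \<Longrightarrow> good (m + int i)" for m n
    proof -
      \<comment> \<open>The state is measured in the norm of the current estimate, so each step pays
        for the perturbation \<open>e\<close> and, through \<open>Nlip\<close>, for the change of
        norm.\<close>
      define w where "w i = N (\<theta>hat (m + int i)) (\<phi> (m + int i))" for i
      have hm: "\<theta>hat (m + int i) \<in> S" for i using m by (intro hat) simp
      have w0: "0 \<le> w i" for i
        unfolding w_def using N(1)[OF hm] norm_ge_zero order_trans by blast
      have "w n \<le> exp D * lam1 ^ n * w 0 + (\<Sum>j<n. exp D * lam1 ^ (n - 1 - j) * (G * \<bar>r (m + int j)\<bar>))"
      proof (rule slowly_varying_recursion[where \<mu> = \<mu> and \<kappa> = \<kappa> and g = "\<lambda>i. K * \<nu> (m + int i)"])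
        fix t assume tn: "t < n"
        let ?t = "m + int t"
        have t: "t0 \<le> ?t" and gt: "good ?t" using m g[OF tn] by auto
        have Suc: "m + int (Suc t) = ?t + 1" by simp
        have "N (\<theta>hat ?t) (\<phi> (?t + 1)) \<le> N (\<theta>hat ?t) (?F (\<theta>hat ?t) (\<phi> ?t))
            + (N (\<theta>hat ?t) (e ?t *\<^sub>R unit_y pos) + N (\<theta>hat ?t) (r ?t *\<^sub>R unit_u pos))"
          unfolding loop[OF t] by (intro order_trans[OF Nadd] add_left_mono Nadd hat t)
        also have "\<dots> \<le> \<mu> * w t + (\<gamma> * (\<nu> ?t * w t) + \<gamma> * \<bar>r ?t\<bar>)"
        proof (intro add_mono)
          show "N (\<theta>hat ?t) (?F (\<theta>hat ?t) (\<phi> ?t)) \<le> \<mu> * w t" unfolding w_def by (rule N(3)[OF hm])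
          have "N (\<theta>hat ?t) (e ?t *\<^sub>R unit_y pos) \<le> \<gamma> * \<bar>e ?t\<bar>"
            using N(2)[OF hm, of t "e ?t *\<^sub>R unit_y pos"] norm_unit_y[OF assms(1)] by simp
          also have "\<dots> \<le> \<gamma> * (\<nu> ?t * w t)"
            unfolding e_\<nu>[OF gt] w_def using \<gamma>L(1) \<nu>0 N(1)[OF hm] by (intro mult_left_mono) auto
          finally show "N (\<theta>hat ?t) (e ?t *\<^sub>R unit_y pos) \<le> \<gamma> * (\<nu> ?t * w t)" .
          show "N (\<theta>hat ?t) (r ?t *\<^sub>R unit_u pos) \<le> \<gamma> * \<bar>r ?t\<bar>"
            using N(2)[OF hm, of t "r ?t *\<^sub>R unit_u pos"] norm_unit_u[OF assms(1)] by simp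
        qed
        finally have bound: "N (\<theta>hat ?t) (\<phi> (?t + 1)) \<le> \<mu> * w t + \<gamma> * (\<nu> ?t * w t) + \<gamma> * \<bar>r ?t\<bar>"
          by simp
        have "w (Suc t) \<le> (1 + C * norm (\<theta>hat (?t + 1) - \<theta>hat ?t)) * N (\<theta>hat ?t) (\<phi> (?t + 1))"
          unfolding w_def Suc using t by (intro Nlip hat) auto
        also have "\<dots> \<le> (1 + C * \<nu> ?t) * (\<mu> * w t + \<gamma> * (\<nu> ?t * w t) + \<gamma> * \<bar>r ?t\<bar>)"
          using bound good_step(1)[OF t gt] C \<nu>0[of ?t] N(1)[OF hm, of "\<phi> (?t + 1)" t]
          by (intro mult_mono add_left_mono mult_left_mono)
             (auto intro: order_trans[OF norm_ge_zero] add_nonneg_nonneg mult_nonneg_nonneg)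
        finally have "w (Suc t) \<le> \<mu> * exp ((C + \<gamma> / \<mu>) * \<nu> ?t) * w t + (1 + C * (2 * R + 1)) * \<gamma> * \<bar>r ?t\<bar>"
          by (rule perturbed_contraction_step[OF C pos(2) \<gamma>L(1) \<nu>0 good_\<nu>[OF t gt] w0 abs_ge_zero])
        also have "\<dots> \<le> \<mu> * exp (K * \<nu> ?t) * w t + G * \<bar>r ?t\<bar>"
          unfolding G_def using K(2) \<nu>0 pos w0 R0 \<gamma>L
          by (intro add_mono mult_right_mono mult_left_mono) (auto intro: mult_right_mono)
        finally show "w (Suc t) \<le> \<mu> * exp (K * \<nu> ?t) * w t + G * \<bar>r ?t\<bar>" .
      next
        fix j assume jn: "j \<le> n"
        show "(\<Sum>i = j..<n. K * \<nu> (m + int i)) \<le> D + \<kappa> * real (n - j)"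
          by (rule average[OF m _ jn]) (rule g)
      qed (use pos \<kappa> w0 G0 in auto)
      also have "\<dots> \<le> cI * lam1 ^ n * norm (\<phi> m) + (\<Sum>j<n. cI * lam1 ^ (n - 1 - j) * \<bar>r (m + int j)\<bar>)"
      proof (intro add_mono sum_mono)
        have "w 0 \<le> (\<gamma> + G) * norm (\<phi> m)"
          using N(2)[OF hm, of 0 "\<phi> m"] mult_nonneg_nonneg[OF G0 norm_ge_zero[of "\<phi> m"]]
          by (simp add: w_def distrib_right)
        then have "exp D * lam1 ^ n * w 0 \<le> exp D * lam1 ^ n * ((\<gamma> + G) * norm (\<phi> m))"
          using pos by (intro mult_left_mono) auto
        then show "exp D * lam1 ^ n * w 0 \<le> cI * lam1 ^ n * norm (\<phi> m)"
          by (simp add: cI_def mult_ac)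
        fix j
        have "exp D * lam1 ^ (n - 1 - j) * (G * \<bar>r (m + int j)\<bar>)
            \<le> exp D * lam1 ^ (n - 1 - j) * ((\<gamma> + G) * \<bar>r (m + int j)\<bar>)"
          using pos \<gamma>L by (intro mult_left_mono mult_right_mono) auto
        then show "exp D * lam1 ^ (n - 1 - j) * (G * \<bar>r (m + int j)\<bar>) \<le> cI * lam1 ^ (n - 1 - j) * \<bar>r (m + int j)\<bar>"
          by (simp add: cI_def mult_ac)
      qed
      finally show ?thesis using N(1)[OF hm, of "\<phi> (m + int n)" n] by (simp add: w_def)
    qed
    have interval': "norm (\<phi> k) \<le> cI * lam1 ^ nat (k - m) * norm (\<phi> m)
        + (\<Sum>j = m..k - 1. cI * lam1 ^ nat (k - 1 - j) * \<bar>r j\<bar>)"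
      if m: "t0 \<le> m" "m \<le> k" and g: "\<And>t. m \<le> t \<Longrightarrow> t < k \<Longrightarrow> good t" for m
    proof -
      define n where "n = nat (k - m)"
      have k_eq: "k = m + int n" using m by (simp add: n_def)
      have "(\<Sum>j = m + int 0..m + int n - 1. cI * lam1 ^ nat (k - 1 - j) * \<bar>r j\<bar>)
          = (\<Sum>j<n. cI * lam1 ^ (n - 1 - j) * \<bar>r (m + int j)\<bar>)"
        unfolding sum_int_shift atLeast0LessThan
        by (rule sum.cong) (auto simp: k_eq nat_diff_distrib' intro!: arg_cong[of _ _ "\<lambda>i. lam1 ^ i"])
      then show ?thesis using interval[of m n] m(1) g by (simp add: k_eq)
    qed

    \<comment> \<open>Restart after the last bad time\<close>
    show "norm (regressor pos y u k) \<le> c1 * lam1 ^ nat (k - t0) * norm \<phi>0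
           + (\<Sum>j=t0..k-1. c1 * lam1 ^ nat (k - 1 - j)
                * (\<bar>filtered_ref pos Astar \<theta>hat ystar j\<bar> + \<bar>d j\<bar>))"
      unfolding \<phi>_def[symmetric] r_def[symmetric]
    proof (cases "\<exists>t. t0 \<le> t \<and> t < k \<and> \<not> good t")
      case False
      have "norm (\<phi> k) \<le> cI * lam1 ^ nat (k - t0) * norm (\<phi> t0)
          + (\<Sum>j = t0..k - 1. cI * lam1 ^ nat (k - 1 - j) * \<bar>r j\<bar>)"
        using False k by (intro interval') auto
      also have "\<dots> \<le> c1 * lam1 ^ nat (k - t0) * norm (\<phi> t0)
          + (\<Sum>j = t0..k - 1. c1 * lam1 ^ nat (k - 1 - j) * (\<bar>r j\<bar> + \<bar>d j\<bar>))"
        using c1 cI0 pos by (intro add_mono sum_mono mult_mono) auto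
      finally show "norm (\<phi> k) \<le> c1 * lam1 ^ nat (k - t0) * norm \<phi>0
          + (\<Sum>j = t0..k - 1. c1 * lam1 ^ nat (k - 1 - j) * (\<bar>r j\<bar> + \<bar>d j\<bar>))"
        by (simp add: init)
    next
      case True
      define m where "m = Max {t. t0 \<le> t \<and> t < k \<and> \<not> good t}"
      have fin: "finite {t. t0 \<le> t \<and> t < k \<and> \<not> good t}"
        by (rule finite_subset[of _ "{t0..k}"]) auto
      have m: "t0 \<le> m" "m < k" "\<not> good m"
        using Max_in[OF fin] True unfolding m_def by blast+
      have after: "good t" if "m + 1 \<le> t" "t < k" for t
        using Max_ge[OF fin, of t] that m(1) unfolding m_def[symmetric] by fastforce
      have "norm (\<phi> m) \<le> \<bar>d m\<bar> / \<upsilon>"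
        using m(3) \<upsilon>(1) by (simp add: good_def field_simps)
      then have "(\<gamma> + 2 * R) * norm (\<phi> m) \<le> (\<gamma> + 2 * R) * (\<bar>d m\<bar> / \<upsilon>)"
        using \<gamma>L R0 by (intro mult_left_mono) auto
      moreover have "norm (\<phi> (m + 1)) \<le> \<gamma> * norm (\<phi> m) + (\<bar>e m\<bar> + \<bar>r m\<bar>)"
      proof -
        have "norm (\<phi> (m + 1)) \<le> norm (?F (\<theta>hat m) (\<phi> m))
            + (norm (e m *\<^sub>R unit_y pos) + norm (r m *\<^sub>R unit_u pos))"
          unfolding loop[OF m(1)] by (intro norm_triangle_le add_left_mono norm_triangle_ineq)
        then show ?thesis
          using F_le[OF hat[OF m(1)], of "\<phi> m"] norm_unit_y[OF assms(1)] norm_unit_u[OF assms(1)] by simp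
      qed
      ultimately have "norm (\<phi> (m + 1)) \<le> ((\<gamma> + 2 * R) / \<upsilon> + 1) * \<bar>d m\<bar> + \<bar>r m\<bar>"
        using e_le[OF m(1)] by (simp add: distrib_right)
      also have "\<dots> \<le> Kb * (\<bar>r m\<bar> + \<bar>d m\<bar>)"
        using mult_right_mono[OF Kb1 abs_ge_zero[of "r m"]] by (simp add: Kb_def[symmetric] distrib_left)
      finally have restart: "norm (\<phi> (m + 1)) \<le> Kb * (\<bar>r m\<bar> + \<bar>d m\<bar>)" .
      \<comment> \<open>The good stretch starts at \<open>m + 1\<close> and may be empty. Its
        initial weight \<open>lam1 ^ nat (k - (m + 1))\<close> is exactly the weight of the summand
        \<open>j = m\<close>, so by \<open>restart\<close> the initial state is absorbed into that
        summand.\<close>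
      have "norm (\<phi> k) \<le> cI * lam1 ^ nat (k - (m + 1)) * norm (\<phi> (m + 1))
          + (\<Sum>j = m + 1..k - 1. cI * lam1 ^ nat (k - 1 - j) * \<bar>r j\<bar>)"
        using m after by (intro interval') auto
      also have "\<dots> \<le> c1 * lam1 ^ nat (k - 1 - m) * (\<bar>r m\<bar> + \<bar>d m\<bar>)
          + (\<Sum>j = m + 1..k - 1. c1 * lam1 ^ nat (k - 1 - j) * (\<bar>r j\<bar> + \<bar>d j\<bar>))"
      proof (intro add_mono)
        have "cI * lam1 ^ nat (k - (m + 1)) * norm (\<phi> (m + 1))
            \<le> cI * lam1 ^ nat (k - (m + 1)) * (Kb * (\<bar>r m\<bar> + \<bar>d m\<bar>))"
          using cI0 pos by (intro mult_left_mono restart) auto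
        also have "\<dots> = (cI * Kb) * (lam1 ^ nat (k - 1 - m) * (\<bar>r m\<bar> + \<bar>d m\<bar>))"
          by (simp add: algebra_simps)
        also have "\<dots> \<le> c1 * (lam1 ^ nat (k - 1 - m) * (\<bar>r m\<bar> + \<bar>d m\<bar>))"
          using c1 pos by (intro mult_right_mono) auto
        finally show "cI * lam1 ^ nat (k - (m + 1)) * norm (\<phi> (m + 1))
            \<le> c1 * lam1 ^ nat (k - 1 - m) * (\<bar>r m\<bar> + \<bar>d m\<bar>)" by (simp add: mult_ac)
        show "(\<Sum>j = m + 1..k - 1. cI * lam1 ^ nat (k - 1 - j) * \<bar>r j\<bar>)
            \<le> (\<Sum>j = m + 1..k - 1. c1 * lam1 ^ nat (k - 1 - j) * (\<bar>r j\<bar> + \<bar>d j\<bar>))"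
          using c1 cI0 pos by (intro sum_mono mult_mono) auto
      qed
      also have "\<dots> = (\<Sum>j \<in> insert m {m + 1..k - 1}. c1 * lam1 ^ nat (k - 1 - j) * (\<bar>r j\<bar> + \<bar>d j\<bar>))"
        by (subst sum.insert) auto
      also have "\<dots> \<le> (\<Sum>j = t0..k - 1. c1 * lam1 ^ nat (k - 1 - j) * (\<bar>r j\<bar> + \<bar>d j\<bar>))"
        using m c1 pos by (intro sum_mono2) auto
      also have "\<dots> \<le> c1 * lam1 ^ nat (k - t0) * norm \<phi>0
          + (\<Sum>j = t0..k - 1. c1 * lam1 ^ nat (k - 1 - j) * (\<bar>r j\<bar> + \<bar>d j\<bar>))"
        using c1 pos by simp
      finally show "norm (\<phi> k) \<le> c1 * lam1 ^ nat (k - t0) * norm \<phi>0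
          + (\<Sum>j = t0..k - 1. c1 * lam1 ^ nat (k - 1 - j) * (\<bar>r j\<bar> + \<bar>d j\<bar>))" .
    qed
  qed
qed

end
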